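(* Let $\epsilon\in(0,1/10)$ and let $\mathcal{A}$ be a TDS learning algorithm for intersections of $2$ homogeneous halfspaces over $\mathbb{R}^d$ w.r.t. $\mathcal{N}_d$ with accuracy $\epsilon$ and success probability at least $0.95$, which accesses the test distribution via SQ queries. Then $\mathcal{A}$ either makes some query of tolerance $\phi=d^{-\omega_\epsilon(1)}$ to the test distribution or runs in time $d^{\omega_\epsilon(1)}$.
   Context: $\mathcal{N}_d$ is the standard Gaussian on $\mathbb{R}^d$. An intersection of 2 homogeneous halfspaces is $\mathbf{x}\mapsto 2(\mathbb{1}\{\mathbf{w}^1\cdot\mathbf{x}\ge0\}\wedge\mathbb{1}\{\mathbf{w}^2\cdot\mathbf{x}\ge0\})-1$. SQ access with tolerance $\phi$ to $\mathcal{D}$: queries $q:\mathbb{R}^d\to[-1,1]$ answered by $v$ with $|v-\mathbb{E}_{\mathcal{D}}[q]|\le\phi$. TDS learning algorithm (accuracy $\epsilon$, success probability $1-\delta$): given labeled examples $(\mathbf{x},c^*(\mathbf{x}))$, $\mathbf{x}\sim\mathcal{N}_d$ i.i.d., $c^*$ in the class, and access to an arbitrary test distribution $\mathcal{D}'$, it rejects or accepts and outputs $h:\mathbb{R}^d\to\{\pm1\}$; with probability $\ge1-\delta$, acceptance implies $\Pr_{\mathbf{x}\sim\mathcal{D}'}[c^*(\mathbf{x})\ne h(\mathbf{x})]\le\epsilon$, and if $\mathcal{D}'=\mathcal{N}_d$ it accepts with probability $\ge1-\delta$. The notation $\omega_\epsilon(1)$ denotes a quantity tending to infinity (as $d\to\infty$)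 for fixed $\epsilon$.
   Formalization: Here ω_ε(1) is an exponent κ(ε), positive for every ε and tending to infinity as ε → 0, with d large for each fixed ε; an exponent unbounded in d for fixed ε is impossible, since moment matching of degree depending only on ε gives a learner with time and inverse tolerance polynomial in d. *)

theory Defs
  imports "HOL-Probability.Probability"
begin

text \<open>
  The statement compares dimensions, so \<open>\<real>\<^sup>d\<close> is rendered with an explicit carrier: a point is a
  function on \<open>nat\<close> of which the coordinates below \<open>d\<close> matter, and the Borel sets are those of the
  finite product \<open>\<Pi>\<^sub>M i\<in>{..<d}. borel\<close> (whose space consists of extensional functions).
\<close>

type_synonym point = "nat \<Rightarrow> real"

definition euclid :: "nat \<Rightarrow> point measure" where
  "euclid d = (\<Pi>\<^sub>M i\<in>{..<d}. borel)"

definition gaussian :: "nat \<Rightarrow> point measure" where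
  "gaussian d = (\<Pi>\<^sub>M i\<in>{..<d}. std_normal_distribution)"

definition dot :: "nat \<Rightarrow> point \<Rightarrow> point \<Rightarrow> real" where
  "dot d w x = (\<Sum>i<d. w i * x i)"

definition halfspace_intersection :: "nat \<Rightarrow> point \<Rightarrow> point \<Rightarrow> point \<Rightarrow> int" where
  "halfspace_intersection d w1 w2 x = 2 * of_bool (dot d w1 x \<ge> 0 \<and> dot d w2 x \<ge> 0) - 1"

definition nonzero_vector :: "nat \<Rightarrow> point \<Rightarrow> bool" where
  "nonzero_vector d w \<longleftrightarrow> (\<exists>i<d. w i \<noteq> 0)"

definition halfspace_intersections2 :: "nat \<Rightarrow> (point \<Rightarrow> int) set" where
  "halfspace_intersections2 d =
     {halfspace_intersection d w1 w2 | w1 w2. nonzero_vector d w1 \<and> nonzero_vector d w2}"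

definition hypotheses :: "nat \<Rightarrow> (point \<Rightarrow> int) set" where
  "hypotheses d = euclid d \<rightarrow>\<^sub>M count_space {-1, 1}"

definition test_distribution :: "nat \<Rightarrow> point measure \<Rightarrow> bool" where
  "test_distribution d D \<longleftrightarrow> prob_space D \<and> sets D = sets (euclid d)"

lemma test_distribution_gaussian: "test_distribution d (gaussian d)"
proof -
  interpret std_normal: prob_space std_normal_distribution
    by (simp add: prob_space_normal_density)
  have "prob_space (gaussian d)"
    unfolding gaussian_def by (intro prob_space_PiM std_normal.prob_space_axioms)
  moreover have "sets (gaussian d) = sets (euclid d)"
    unfolding gaussian_def euclid_def by (intro sets_PiM_cong) auto
  ultimately show ?thesis by (simp add: test_distribution_def)
qed

subsection \<open>Statistical queries\<close>

definition sq_query :: "nat \<Rightarrow> (point \<Rightarrow> real) \<Rightarrow> real \<Rightarrow> bool" where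
  "sq_query d q \<phi> \<longleftrightarrow> q \<in> borel_measurable (euclid d) \<and> (\<forall>x\<in>space (euclid d). q x \<in> {-1..1}) \<and> 0 \<le> \<phi>"

text \<open>
  Oracles map a query and the requested tolerance to an answer. Nothing is promised about inputs
  that are not queries (e.g. a negative tolerance).
\<close>

definition sq_oracle :: "nat \<Rightarrow> point measure \<Rightarrow> ((point \<Rightarrow> real) \<Rightarrow> real \<Rightarrow> real) \<Rightarrow> bool" where
  "sq_oracle d D v \<longleftrightarrow> (\<forall>q \<phi>. sq_query d q \<phi> \<longrightarrow> \<bar>v q \<phi> - integral\<^sup>L D q\<bar> \<le> \<phi>)"

subsection \<open>Algorithms and running time\<close>

text \<open>
  An algorithm chooses its next elementary step from the responses seen so far; a step is an internal
  computation step, a coin toss, a request for one training example, or one query to the test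
  distribution. The running time is the number of steps. The transition function is arbitrary and
  nonuniform in \<open>d\<close>, so that a program of any concrete machine model is an algorithm in this sense with its own
  running time (each machine operation being one \<open>Compute\<close> step); a lower bound here is one
  for all such models.
\<close>

datatype action =
    Compute
  | Coin
  | Example
  | Query "point \<Rightarrow> real" real
  | Reject
  | Accept "point \<Rightarrow> int"

datatype response =
    Done
  | Tossed bool
  | Labeled point int
  | Answer real

type_synonym algorithm = "response list \<Rightarrow> action"

record environment =
  concept :: "point \<Rightarrow> int"
  sq_answers :: "(point \<Rightarrow> real) \<Rightarrow> real \<Rightarrow> real"
  samples :: "nat \<Rightarrow> point"
  coins :: "nat \<Rightarrow> bool"

text \<open>
  An example or coin requested in step \<open>t\<close> is the \<open>t\<close>-th entry of the respective i.i.d. sequence;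
  the entries not requested are discarded, so the ones received are again i.i.d.
\<close>

fun respond :: "environment \<Rightarrow> nat \<Rightarrow> action \<Rightarrow> response" where
  "respond E t Coin = Tossed (coins E t)"
| "respond E t Example = Labeled (samples E t) (concept E (samples E t))"
| "respond E t (Query q \<phi>) = Answer (sq_answers E q \<phi>)"
| "respond E t _ = Done"

fun halting :: "action \<Rightarrow> bool" where
  "halting Reject = True"
| "halting (Accept h) = True"
| "halting _ = False"

primrec history :: "algorithm \<Rightarrow> environment \<Rightarrow> nat \<Rightarrow> response list" where
  "history A E 0 = []"
| "history A E (Suc t) =
     (let a = A (history A E t) in
      if halting a then history A E t else history A E t @ [respond E t a])"

definition action_at :: "algorithm \<Rightarrow> environment \<Rightarrow> nat \<Rightarrow> action" where
  "action_at A E t = A (history A E t)"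

definition accepts_with :: "algorithm \<Rightarrow> environment \<Rightarrow> (point \<Rightarrow> int) \<Rightarrow> bool" where
  "accepts_with A E h \<longleftrightarrow> (\<exists>t. action_at A E t = Accept h)"

definition makes_query :: "algorithm \<Rightarrow> environment \<Rightarrow> (point \<Rightarrow> real) \<Rightarrow> real \<Rightarrow> bool" where
  "makes_query A E q \<phi> \<longleftrightarrow> (\<exists>t. action_at A E t = Query q \<phi>)"

definition takes_steps :: "algorithm \<Rightarrow> environment \<Rightarrow> nat \<Rightarrow> bool" where
  "takes_steps A E n \<longleftrightarrow> (\<forall>t<n. \<not> halting (action_at A E t))"

text \<open>The environments in which an algorithm may be run; tolerances and running times are worst case
  over these.\<close>

definition environments :: "nat \<Rightarrow> (point \<Rightarrow> int) set \<Rightarrow> environment set" where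
  "environments d C =
     {E. concept E \<in> C \<and> (\<exists>D. test_distribution d D \<and> sq_oracle d D (sq_answers E)) \<and>
         (\<forall>t. samples E t \<in> space (euclid d))}"

subsection \<open>Testable learning with distribution shift\<close>

definition randomness :: "nat \<Rightarrow> ((nat \<Rightarrow> point) \<times> (nat \<Rightarrow> bool)) measure" where
  "randomness d = (\<Pi>\<^sub>M t\<in>(UNIV :: nat set). gaussian d) \<Otimes>\<^sub>M
                  (\<Pi>\<^sub>M t\<in>(UNIV :: nat set). measure_pmf (bernoulli_pmf (1/2)))"

text \<open>
  Oracles and algorithms carry no measurability assumption, so an event need not be measurable; it has
  probability at least \<open>p\<close> if it contains a measurable event that does.
\<close>

definition with_probability :: "'a measure \<Rightarrow> real \<Rightarrow> ('a \<Rightarrow> bool) \<Rightarrow> bool" where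
  "with_probability M p P \<longleftrightarrow> (\<exists>G\<in>sets M. p \<le> measure M G \<and> (\<forall>\<omega>\<in>G. P \<omega>))"

definition env :: "(point \<Rightarrow> int) \<Rightarrow> ((point \<Rightarrow> real) \<Rightarrow> real \<Rightarrow> real) \<Rightarrow>
    (nat \<Rightarrow> point) \<times> (nat \<Rightarrow> bool) \<Rightarrow> environment" where
  "env c v \<omega> = \<lparr>concept = c, sq_answers = v, samples = fst \<omega>, coins = snd \<omega>\<rparr>"

definition tds_learner ::
  "nat \<Rightarrow> (point \<Rightarrow> int) set \<Rightarrow> real \<Rightarrow> real \<Rightarrow> algorithm \<Rightarrow> bool" where
  "tds_learner d C \<epsilon> \<delta> A \<longleftrightarrow>
     (\<forall>c\<in>C. \<forall>D v. test_distribution d D \<longrightarrow> sq_oracle d D v \<longrightarrow>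
        with_probability (randomness d) (1 - \<delta>)
          (\<lambda>\<omega>. \<forall>h. accepts_with A (env c v \<omega>) h \<longrightarrow>
                 h \<in> hypotheses d \<and> measure D {x \<in> space D. c x \<noteq> h x} \<le> \<epsilon>) \<and>
        (D = gaussian d \<longrightarrow>
           with_probability (randomness d) (1 - \<delta>) (\<lambda>\<omega>. \<exists>h. accepts_with A (env c v \<omega>) h)))"

subsection \<open>The exponent\<close>

text \<open>
  A quantity \<open>d\<close> to the power \<open>\<omega>\<^sub>\<epsilon>(1)\<close> is one that, for each fixed \<open>\<epsilon>\<close> and all large \<open>d\<close>, is at
  least \<open>d powr \<kappa> \<epsilon>\<close>, where \<open>\<kappa> \<epsilon>\<close> is positive and tends to infinity as \<open>\<epsilon>\<close> tends to \<open>0\<close>. An exponent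
  unbounded in \<open>d\<close> for a fixed \<open>\<epsilon>\<close> is impossible: matching all moments up to a degree depending only
  on \<open>\<epsilon>\<close> yields a TDS learner with running time and inverse tolerance polynomial in \<open>d\<close>.
\<close>

definition omega_exponent :: "(real \<Rightarrow> real) \<Rightarrow> bool" where
  "omega_exponent \<kappa> \<longleftrightarrow> (\<forall>\<epsilon>>0. \<kappa> \<epsilon> > 0) \<and> filterlim \<kappa> at_top (at_right 0)"

end

theory Submission
  imports Defs "HOL-Real_Asymp.Real_Asymp"
begin

text \<open>
  For a unit vector \<open>w\<close> orthogonal to the first axis, the concepts with positive region
  \<open>\<bar>w \<bullet> x\<bar> \<le> \<plusminus> \<gamma> x\<^sub>0\<close> are thin wedges that training samples almost never hit, so the learner cannot tell
  the two apart. Tilt the Gaussian along \<open>w\<close> so that it has a spike at \<open>0\<close> much thinner than \<open>\<gamma>\<close> but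
  agrees with it in all moments up to degree \<open>2 k + 1\<close>; if the mass of the spike exceeds a
  multiple of \<open>\<epsilon>\<close>, no hypothesis is accurate for both concepts and the learner must
  not accept. Under the Gaussian itself it must, so its queries distinguish the
  tilted distributions for most \<open>w\<close> in any family. By the matching moments the relative densities for
  \<open>w\<close> and \<open>w'\<close> have correlation \<open>O((w \<bullet> w')\<^bsup>2k+2\<^esup>)\<close>, hence in a nearly orthogonal family a single query
  distinguishes few \<open>w\<close>. The \<open>k\<close> that this allows tends to infinity as \<open>\<epsilon>\<close> tends to \<open>0\<close>.

  The wedges have positive angle because for \<open>\<gamma> = 0\<close> one query, the indicator of a union of
  hyperplanes, would recognise a whole finite family.
\<close>

subsection \<open>Gaussian integrals\<close>

text \<open>One obstacle is adaptivity: queries may depend on samples, coins and earlier answers.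
  Averaging fixes one outcome of samples and coins that is good for 4/5 of the directions. For all
  of these the labels are -1, and an oracle for the tilted distribution repeats the Gaussian answer
  whenever the tolerance allows. Hence one deterministic Gaussian run of fewer than n steps must
  contain, for each of these directions, a query that separates its tilted distribution from the
  Gaussian. The other obstacle is the coupling of time and angle. A run of n steps calls for
  \<open>\<gamma>\<close> of order 1 / n^2, the spike inside the wedge has width h of order
  \<open>\<gamma>\<close>^2, and the relative densities are bounded only by 2 / h. This loss is
  polynomial in n and is paid for by the size of the family, which can be any fixed power of d. The
  degree k is limited from elsewhere: compensating the spike is extrapolation, and nonnegativity of
  the tilted density is secured by scaling the spike down to a mass that decreases with k but has to
  stay above a multiple of \<open>\<epsilon>\<close>.\<close>

abbreviation sqlen :: "nat \<Rightarrow> point \<Rightarrow> real" where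
  "sqlen d w \<equiv> dot d w w"

lemma prob_space_gaussian: "prob_space (gaussian d)"
  using test_distribution_gaussian by (simp add: test_distribution_def)

lemma sets_gaussian: "sets (gaussian d) = sets (euclid d)"
  using test_distribution_gaussian by (simp add: test_distribution_def)

lemma space_gaussian: "space (gaussian d) = space (euclid d)"
  using sets_gaussian by (rule sets_eq_imp_space_eq)

lemma measurable_gaussian: "measurable (gaussian d) N = measurable (euclid d) N"
  by (rule measurable_cong_sets[OF sets_gaussian refl])

lemma dot_measurable [measurable]: "dot d w \<in> borel_measurable (euclid d)"
  unfolding dot_def euclid_def by measurable

lemma component_measurable: "i < d \<Longrightarrow> (\<lambda>x. x i) \<in> borel_measurable (euclid d)"
  unfolding euclid_def by measurable

lemma dot_linear_comb: "dot d (\<lambda>i. s * u i + t * w i) x = s * dot d u x + t * dot d w x"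
  by (simp add: dot_def sum.distrib sum_distrib_left distrib_right mult.assoc)

lemma dot_commute: "dot d u w = dot d w u"
  by (simp add: dot_def mult.commute)

lemma char_function_gaussian:
  "(CLINT x|gaussian d. iexp (dot d u x)) = exp (- sqlen d u / 2)"
proof -
  interpret prob_space std_normal_distribution
    by (simp add: prob_space_normal_density)
  interpret product_sigma_finite "\<lambda>i::nat. std_normal_distribution"
    by unfold_locales
  have "(CLINT x|gaussian d. iexp (dot d u x)) =
      (CLINT x|gaussian d. (\<Prod>i<d. iexp (u i * x i)))"
    by (simp add: dot_def sum_distrib_left exp_sum)
  also have "\<dots> = (\<Prod>i<d. CLINT t|std_normal_distribution. iexp (u i * t))"
    unfolding gaussian_def
    by (rule product_integral_prod) (auto intro!: integrable_const_bound[where B = 1])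
  also have "\<dots> = (\<Prod>i<d. char std_normal_distribution (u i))"
    by (simp add: char_def)
  also have "\<dots> = (\<Prod>i<d. complex_of_real (exp (- (u i)\<^sup>2 / 2)))"
    by (simp add: char_std_normal_distribution)
  also have "\<dots> = exp (- sqlen d u / 2)"
    by (simp add: dot_def flip: of_real_prod exp_sum)
       (simp add: sum_negf sum_divide_distrib power2_eq_square)
  finally show ?thesis .
qed

text \<open>Completing the square: times the standard density, the integrand is a multiple of the
  normal density with mean \<open>e / (1 + p)\<close> and variance
  \<open>1 / (1 + p)\<close>.\<close>

lemma std_normal_integral_exp:
  assumes p: "p > -1"
  shows "integrable std_normal_distribution (\<lambda>z. exp (e * z - p * z\<^sup>2 / 2))" (is ?A)
    and "(LINT z|std_normal_distribution. exp (e * z - p * z\<^sup>2 / 2)) =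
      exp (e\<^sup>2 / (2 * (1 + p))) / sqrt (1 + p)" (is ?B)
proof -
  let ?C = "exp (e\<^sup>2 / (2 * (1 + p))) / sqrt (1 + p)"
  have q: "1 + p > 0" using p by simp
  have *: "std_normal_density z *\<^sub>R exp (e * z - p * z\<^sup>2 / 2) =
      ?C * normal_density (e / (1 + p)) (1 / sqrt (1 + p)) z" for z
  proof -
    have "- z\<^sup>2 / 2 + (e * z - p * z\<^sup>2 / 2) =
        e\<^sup>2 / (2 * (1 + p)) - (z - e / (1 + p))\<^sup>2 / (2 * (1 / sqrt (1 + p))\<^sup>2)"
    proof -
      have "(z - e / (1 + p))\<^sup>2 / (2 * (1 / sqrt (1 + p))\<^sup>2) = (1 + p) * (z - e / (1 + p))\<^sup>2 / 2"
        using q by (simp add: power_divide)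
      also have "\<dots> = (1 + p) * z\<^sup>2 / 2 - e * z + e\<^sup>2 / (2 * (1 + p))"
        using q by (simp add: power2_eq_square divide_simps) (simp add: algebra_simps)
      finally show ?thesis by (simp add: algebra_simps add_divide_distrib)
    qed
    then have "exp (- z\<^sup>2 / 2) * exp (e * z - p * z\<^sup>2 / 2) =
        exp (e\<^sup>2 / (2 * (1 + p))) * exp (- (z - e / (1 + p))\<^sup>2 / (2 * (1 / sqrt (1 + p))\<^sup>2))"
      by (simp flip: exp_add)
    moreover have "1 / sqrt (2 * pi) = 1 / sqrt (1 + p) * (1 / sqrt (2 * pi * (1 / sqrt (1 + p))\<^sup>2))"
      using q by (simp add: real_sqrt_mult real_sqrt_divide power_divide)
    ultimately show ?thesis
      unfolding normal_density_def by (simp add: power_divide mult.commute)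
  qed
  have "integrable lborel (\<lambda>z. ?C * normal_density (e / (1 + p)) (1 / sqrt (1 + p)) z)"
    using q by (intro integrable_mult_right integrable_normal_density) simp
  then show ?A
    by (subst integrable_density) (auto simp: * simp del: real_scaleR_def)
  show ?B
    using q by (subst integral_density) (auto simp: * simp del: real_scaleR_def)
qed

text \<open>Expanding the Gaussian factor as a characteristic function reduces both integrals below to
  \<open>char_function_gaussian\<close>.\<close>

lemma gaussian_fourier_swap:
  fixes F :: "point \<Rightarrow> complex"
  assumes F: "F \<in> borel_measurable (euclid d)" "\<And>x. norm (F x) \<le> 1" and c: "c \<ge> 0"
  shows "(CLINT x|gaussian d. F x * exp (- c * (dot d w x)\<^sup>2 / 2)) =
    (CLINT z|std_normal_distribution. CLINT x|gaussian d. F x * iexp (sqrt c * z * dot d w x))"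
proof -
  interpret N: prob_space std_normal_distribution
    by (simp add: prob_space_normal_density)
  interpret G: prob_space "gaussian d" by (rule prob_space_gaussian)
  interpret P: pair_prob_space "gaussian d" std_normal_distribution ..
  have [measurable]: "F \<in> borel_measurable (gaussian d)" "dot d w \<in> borel_measurable (gaussian d)"
    using F(1) by (simp_all add: measurable_gaussian)
  have "(CLINT x|gaussian d. F x * exp (- c * (dot d w x)\<^sup>2 / 2)) =
      (CLINT x|gaussian d. CLINT z|std_normal_distribution. F x * iexp (sqrt c * z * dot d w x))"
  proof (intro Bochner_Integration.integral_cong refl)
    fix x
    have "complex_of_real (exp (- c * (dot d w x)\<^sup>2 / 2)) =
        char std_normal_distribution (sqrt c * dot d w x)"
      using c by (simp add: char_std_normal_distribution power_mult_distrib)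
    also have "\<dots> = (CLINT z|std_normal_distribution. iexp (sqrt c * z * dot d w x))"
      by (simp add: char_def mult_ac)
    finally show "F x * exp (- c * (dot d w x)\<^sup>2 / 2) =
        (CLINT z|std_normal_distribution. F x * iexp (sqrt c * z * dot d w x))"
      by simp
  qed
  also have "\<dots> = (CLINT z|std_normal_distribution. CLINT x|gaussian d.
      F x * iexp (sqrt c * z * dot d w x))"
    by (rule P.Fubini_integral[symmetric])
       (use F(2) in \<open>auto intro!: P.integrable_const_bound[where B = 1] simp: norm_mult\<close>)
  finally show ?thesis .
qed

text \<open>After the swap the two characters merge into that of \<open>u + sqrt c * z * w\<close>,
  whose Gaussian integral is the exponential of a quadratic in \<open>z\<close>. The free vector
  \<open>u\<close> lets a second exponential factor be expanded in the same way.\<close>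

lemma gaussian_integral_char_exp:
  assumes c: "c \<ge> 0" and w: "sqlen d w = 1"
  shows "(CLINT x|gaussian d. iexp (dot d u x) * exp (- c * (dot d w x)\<^sup>2 / 2)) =
    exp (c * (dot d u w)\<^sup>2 / (2 * (1 + c)) - sqlen d u / 2) / sqrt (1 + c)"
proof -
  have "(CLINT x|gaussian d. iexp (dot d u x) * exp (- c * (dot d w x)\<^sup>2 / 2)) =
      (CLINT z|std_normal_distribution. CLINT x|gaussian d.
        iexp (dot d u x) * iexp (sqrt c * z * dot d w x))"
    by (rule gaussian_fourier_swap) (use c in auto)
  also have "\<dots> = (CLINT z|std_normal_distribution.
      complex_of_real (exp (- sqlen d u / 2) * exp (- (sqrt c * dot d u w) * z - c * z\<^sup>2 / 2)))"
  proof (intro Bochner_Integration.integral_cong refl)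
    fix z
    let ?v = "\<lambda>i. 1 * u i + (sqrt c * z) * w i"
    have "(CLINT x|gaussian d. iexp (dot d u x) * iexp (sqrt c * z * dot d w x)) =
        (CLINT x|gaussian d. iexp (dot d ?v x))"
      by (simp only: dot_linear_comb) (simp add: exp_add distrib_left)
    also have "\<dots> = exp (- sqlen d ?v / 2)"
      by (rule char_function_gaussian)
    also have "sqlen d ?v = sqlen d u + 2 * (sqrt c * z) * dot d u w + (sqrt c * z)\<^sup>2 * sqlen d w"
      unfolding dot_linear_comb
      by (simp only: dot_commute[of d u ?v] dot_commute[of d w ?v] dot_linear_comb)
         (simp add: algebra_simps power2_eq_square dot_commute[of d w u])
    also have "exp (- \<dots> / 2) = exp (- sqlen d u / 2) * exp (- (sqrt c * dot d u w) * z - c * z\<^sup>2 / 2)"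
      using c w by (simp add: power_mult_distrib field_simps flip: exp_add)
    finally show "(CLINT x|gaussian d. iexp (dot d u x) * iexp (sqrt c * z * dot d w x)) =
        complex_of_real (exp (- sqlen d u / 2) * exp (- (sqrt c * dot d u w) * z - c * z\<^sup>2 / 2))" .
  qed
  also have "\<dots> = complex_of_real (exp (- sqlen d u / 2) * (exp (c * (dot d u w)\<^sup>2 / (2 * (1 + c))) / sqrt (1 + c)))"
    using c std_normal_integral_exp(2)[of c "- (sqrt c * dot d u w)"]
    by (subst integral_complex_of_real) (simp add: power_mult_distrib)
  also have "exp (- sqlen d u / 2) * (exp (c * (dot d u w)\<^sup>2 / (2 * (1 + c))) / sqrt (1 + c)) =
      exp (c * (dot d u w)\<^sup>2 / (2 * (1 + c)) - sqlen d u / 2) / sqrt (1 + c)"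
    unfolding times_divide_eq_right exp_add[symmetric] by (simp add: algebra_simps)
  finally show ?thesis .
qed

text \<open>Only the second factor is expanded into characters; the inner integral is then the
  previous one with \<open>u\<close> a multiple of \<open>w'\<close>. No covariance matrix is
  inverted, so \<open>w = w'\<close> is covered as well.\<close>

lemma gaussian_integral_exp_exp:
  assumes c: "c \<ge> 0" "c' \<ge> 0" and w: "sqlen d w = 1" "sqlen d w' = 1"
    and r: "(dot d w w')\<^sup>2 \<le> 1"
  shows "(LINT x|gaussian d. exp (- c * (dot d w x)\<^sup>2 / 2) * exp (- c' * (dot d w' x)\<^sup>2 / 2)) =
    1 / sqrt ((1 + c) * (1 + c') - c * c' * (dot d w w')\<^sup>2)"
proof -
  let ?r = "dot d w w'"
  let ?p = "c' - c * c' * ?r\<^sup>2 / (1 + c)"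
  have "c * ?r\<^sup>2 \<le> 1 + c"
    using mult_left_mono[OF r c(1)] by simp
  then have p0: "?p \<ge> 0"
    using c mult_left_mono[of "c * ?r\<^sup>2" "1 + c" c'] by (simp add: field_simps)
  have "(CLINT x|gaussian d. complex_of_real (exp (- c * (dot d w x)\<^sup>2 / 2)) * complex_of_real (exp (- c' * (dot d w' x)\<^sup>2 / 2))) =
    (CLINT z|std_normal_distribution. CLINT x|gaussian d.
        complex_of_real (exp (- c * (dot d w x)\<^sup>2 / 2)) * iexp (sqrt c' * z * dot d w' x))"
    by (rule gaussian_fourier_swap) (use c in auto)
  also have "\<dots> = (CLINT z|std_normal_distribution.
      complex_of_real (1 / sqrt (1 + c) * exp (0 * z - ?p * z\<^sup>2 / 2)))"
  proof (intro Bochner_Integration.integral_cong refl)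
    fix z
    \<comment> \<open>The zero summand brings a plain multiple of \<open>w'\<close> into the shape
      of \<open>dot_linear_comb\<close>.\<close>
    let ?v = "\<lambda>i. (sqrt c' * z) * w' i + 0 * w' i"
    have v: "dot d ?v x = sqrt c' * z * dot d w' x" for x
      by (subst dot_linear_comb) simp
    have "(CLINT x|gaussian d. complex_of_real (exp (- c * (dot d w x)\<^sup>2 / 2)) * iexp (sqrt c' * z * dot d w' x)) =
      (CLINT x|gaussian d. iexp (dot d ?v x) * exp (- c * (dot d w x)\<^sup>2 / 2))"
      by (simp only: v) (simp add: mult.commute)
    also have "\<dots> = exp (c * (dot d ?v w)\<^sup>2 / (2 * (1 + c)) - sqlen d ?v / 2) / sqrt (1 + c)"
      by (rule gaussian_integral_char_exp) fact+
    also have "sqlen d ?v = c' * z\<^sup>2"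
      unfolding v by (subst dot_commute, unfold v) (use c w in \<open>simp add: power2_eq_square\<close>)
    also have "dot d ?v w = sqrt c' * z * ?r"
      unfolding v by (simp add: dot_commute)
    also have "c * (sqrt c' * z * ?r)\<^sup>2 / (2 * (1 + c)) - c' * z\<^sup>2 / 2 = 0 * z - ?p * z\<^sup>2 / 2"
      using c by (simp add: power_mult_distrib divide_simps) (simp add: algebra_simps)
    finally show "(CLINT x|gaussian d. complex_of_real (exp (- c * (dot d w x)\<^sup>2 / 2)) * iexp (sqrt c' * z * dot d w' x)) =
       complex_of_real (1 / sqrt (1 + c) * exp (0 * z - ?p * z\<^sup>2 / 2))"
      by simp
  qed
  also have "\<dots> = complex_of_real (1 / sqrt (1 + c) * (1 / sqrt (1 + ?p)))"
    using p0 std_normal_integral_exp(2)[of ?p 0]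
    by (subst integral_complex_of_real) simp
  also have "1 / sqrt (1 + c) * (1 / sqrt (1 + ?p)) = 1 / sqrt ((1 + c) * (1 + ?p))"
    by (simp add: real_sqrt_mult)
  also have "(1 + c) * (1 + ?p) = (1 + c) * (1 + c') - c * c' * ?r\<^sup>2"
    using c by (simp add: field_simps)
  finally show ?thesis
    by (simp only: integral_complex_of_real of_real_eq_iff flip: of_real_mult)
qed

text \<open>The ratio of the density of the normal distribution with variance \<open>a\<close> to the standard one.\<close>

definition ratio :: "real \<Rightarrow> real \<Rightarrow> real" where
  "ratio a t = exp (- (1 / a - 1) * t\<^sup>2 / 2) / sqrt a"

lemma ratio_measurable [measurable]: "ratio a \<in> borel_measurable borel"
  unfolding ratio_def by measurable

lemma ratio_1 [simp]: "ratio 1 t = 1"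
  by (simp add: ratio_def)

lemma ratio_pos: "a > 0 \<Longrightarrow> ratio a t > 0"
  by (simp add: ratio_def)

lemma ratio_le:
  assumes "a \<in> {0<..1}"
  shows "ratio a t \<le> 1 / sqrt a"
proof -
  have "0 \<le> (1 / a - 1) * t\<^sup>2"
    using assms by (intro mult_nonneg_nonneg) auto
  then have "exp (- (1 / a - 1) * t\<^sup>2 / 2) \<le> 1"
    unfolding exp_le_one_iff mult_minus_left minus_divide_left[symmetric] neg_le_0_iff_le
    by (rule divide_nonneg_nonneg) simp
  then show ?thesis
    using assms unfolding ratio_def by (intro divide_right_mono) auto
qed

lemma ratio_integrable:
  assumes "a \<in> {0<..1}"
  shows "integrable (gaussian d) (\<lambda>x. ratio a (dot d w x))"
proof -
  interpret G: prob_space "gaussian d" by (rule prob_space_gaussian)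
  show ?thesis
    by (rule G.integrable_const_bound[where B = "1 / sqrt a"])
       (use assms ratio_le[of a] ratio_pos[of a] in \<open>auto simp: measurable_gaussian abs_of_pos\<close>)
qed

lemma ratio_prod_integrable:
  assumes "a \<in> {0<..1}" "b \<in> {0<..1}"
  shows "integrable (gaussian d) (\<lambda>x. ratio a (dot d w x) * ratio b (dot d w' x))"
proof -
  interpret G: prob_space "gaussian d" by (rule prob_space_gaussian)
  have "norm (ratio a s * ratio b t) \<le> 1 / sqrt a * (1 / sqrt b)" for s t
    using assms ratio_le[of a s] ratio_pos[of a s] ratio_le[of b t] ratio_pos[of b t]
    unfolding norm_mult by (intro mult_mono) auto
  then show ?thesis
    by (intro G.integrable_const_bound[where B = "1 / sqrt a * (1 / sqrt b)"])
       (auto simp: measurable_gaussian)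
qed

text \<open>The value depends only on the product of \<open>(dot d w w')^2\<close>,
  \<open>1 - a\<close> and \<open>1 - b\<close>. This makes \<open>1 - a\<close> the natural
  parameter: correlations of combinations of ratios become power sums of it. With
  \<open>b = 1\<close> it yields total mass 1, with orthogonal directions independence.\<close>

lemma ratio_correlation:
  assumes ab: "a \<in> {0<..1}" "b \<in> {0<..1}" and w: "sqlen d w = 1" "sqlen d w' = 1"
    and r: "(dot d w w')\<^sup>2 \<le> 1"
  shows "(LINT x|gaussian d. ratio a (dot d w x) * ratio b (dot d w' x)) =
    1 / sqrt (1 - (dot d w w')\<^sup>2 * (1 - a) * (1 - b))"
proof -
  let ?r = "dot d w w'"
  have c: "1 / a - 1 \<ge> 0" "1 / b - 1 \<ge> 0" using ab by auto
  have "(LINT x|gaussian d. ratio a (dot d w x) * ratio b (dot d w' x)) =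
    (LINT x|gaussian d. exp (- (1 / a - 1) * (dot d w x)\<^sup>2 / 2) * exp (- (1 / b - 1) * (dot d w' x)\<^sup>2 / 2)) / (sqrt a * sqrt b)"
    by (subst integral_divide_zero[symmetric]) (simp add: ratio_def)
  also have "\<dots> = 1 / sqrt ((1 + (1 / a - 1)) * (1 + (1 / b - 1)) - (1 / a - 1) * (1 / b - 1) * ?r\<^sup>2) / (sqrt a * sqrt b)"
    using gaussian_integral_exp_exp[OF c w r] by simp
  also have "\<dots> = 1 / sqrt (((1 + (1 / a - 1)) * (1 + (1 / b - 1)) - (1 / a - 1) * (1 / b - 1) * ?r\<^sup>2) * (a * b))"
    by (simp add: real_sqrt_mult)
  also have "((1 + (1 / a - 1)) * (1 + (1 / b - 1)) - (1 / a - 1) * (1 / b - 1) * ?r\<^sup>2) * (a * b)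
     = 1 - ?r\<^sup>2 * (1 - a) * (1 - b)"
    using ab by (simp add: field_simps)
  finally show ?thesis .
qed

lemma ratio_integral:
  assumes "a \<in> {0<..1}" "sqlen d w = 1"
  shows "(LINT x|gaussian d. ratio a (dot d w x)) = 1"
  using ratio_correlation[of a 1 d w w] assms by simp

subsection \<open>Power series, extrapolation and codes\<close>

text \<open>Consecutive coefficients have ratio -(n + 1/2) / (n + 1), which is below 1 in absolute
  value.\<close>

lemma abs_gbinomial_neg_half_le: "\<bar>(- 1 / 2 :: real) gchoose n\<bar> \<le> 1"
proof (induction n)
  case (Suc n)
  have "real (Suc n) * ((- 1 / 2) gchoose Suc n) = (- 1 / 2 - real n) * ((- 1 / 2) gchoose n)"
    using gbinomial_mult_1[of "- 1 / 2 :: real" n] by (simp add: algebra_simps)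
  then have "real (Suc n) * \<bar>(- 1 / 2) gchoose Suc n\<bar> = (1 / 2 + real n) * \<bar>(- 1 / 2) gchoose n\<bar>"
    by (metis (no_types, lifting) abs_mult abs_of_nat abs_of_nonneg abs_minus_commute
        add.commute add_divide_distrib diff_minus_eq_add minus_diff_eq abs_minus_cancel
        minus_divide_left of_nat_0_le_iff add_nonneg_nonneg zero_le_divide_1_iff zero_le_numeral)
  also have "\<dots> \<le> real (Suc n) * 1"
    using Suc by (intro mult_mono) auto
  finally show ?case by (simp del: of_nat_Suc)
qed simp

text \<open>Vanishing power sums kill the low order terms of the expansion of \<open>(1 - z) powr (- 1 / 2)\<close>.\<close>

lemma inverse_sqrt_quadratic_form_bound:
  fixes c b :: "'a \<Rightarrow> real" and r :: real
  assumes J: "finite J" and b: "\<And>j. j \<in> J \<Longrightarrow> \<bar>b j\<bar> \<le> 1"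
    and low: "\<And>n. n \<le> k \<Longrightarrow> (\<Sum>j\<in>J. c j * b j ^ n) = 0"
    and bound: "\<And>n. \<bar>\<Sum>j\<in>J. c j * b j ^ n\<bar> \<le> 1"
    and r: "r\<^sup>2 \<le> 1 / 2"
  shows "\<bar>\<Sum>i\<in>J. \<Sum>j\<in>J. c i * c j / sqrt (1 - r\<^sup>2 * b i * b j)\<bar> \<le> 2 * r ^ (2 * k + 2)"
proof -
  define f :: "nat \<Rightarrow> real" where "f n = ((- 1 / 2) gchoose n) * (- 1) ^ n" for n
  define S where "S n = (\<Sum>j\<in>J. c j * b j ^ n)" for n
  have f: "\<bar>f n\<bar> \<le> 1" for n
    using abs_gbinomial_neg_half_le[of n] by (simp add: f_def abs_mult power_abs)
  have series: "(\<lambda>n. f n * z ^ n) sums (1 / sqrt (1 - z))" if z: "\<bar>z\<bar> < 1" for z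
  proof -
    have "(\<lambda>n. ((- 1 / 2) gchoose n) * (- z) ^ n) sums (1 + - z) powr (- 1 / 2)"
      by (rule gen_binomial_real) (use z in simp)
    moreover have "(- z) ^ n = (- 1) ^ n * z ^ n" for n
      by (simp flip: power_mult_distrib)
    moreover have "(1 + - z) powr (- 1 / 2) = 1 / sqrt (1 - z)"
      using z by (simp add: powr_minus_divide powr_half_sqrt)
    ultimately show ?thesis by (simp add: f_def mult_ac)
  qed
  have "(\<lambda>n. \<Sum>i\<in>J. \<Sum>j\<in>J. c i * c j * (f n * (r\<^sup>2 * b i * b j) ^ n)) sums
      (\<Sum>i\<in>J. \<Sum>j\<in>J. c i * c j * (1 / sqrt (1 - r\<^sup>2 * b i * b j)))"
  proof (intro sums_sum sums_mult series)
    fix i j assume "i \<in> J" "j \<in> J"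
    then have "r\<^sup>2 * (\<bar>b i\<bar> * \<bar>b j\<bar>) \<le> 1 / 2 * (1 * 1)"
      using b r by (intro mult_mono) auto
    then show "\<bar>r\<^sup>2 * b i * b j\<bar> < 1" by (simp add: abs_mult mult.assoc)
  qed
  \<comment> \<open>The kernel sees \<open>i\<close> and \<open>j\<close> only through
    \<open>b i * b j\<close>, so each order of the double sum is a multiple of the square of one
    power sum \<open>S n\<close>.\<close>
  moreover have "(\<Sum>i\<in>J. \<Sum>j\<in>J. c i * c j * (f n * (r\<^sup>2 * b i * b j) ^ n)) = f n * (r\<^sup>2) ^ n * (S n)\<^sup>2" for n
    unfolding S_def power2_eq_square[of "sum _ _"] sum_product sum_distrib_left
    by (intro sum.cong refl) (simp add: power_mult_distrib sum_distrib_left mult_ac)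
  ultimately have sums: "(\<lambda>n. f n * (r\<^sup>2) ^ n * (S n)\<^sup>2) sums
      (\<Sum>i\<in>J. \<Sum>j\<in>J. c i * c j / sqrt (1 - r\<^sup>2 * b i * b j))" (is "_ sums ?T")
    by simp
  have shifted: "(\<lambda>n. f (n + Suc k) * (r\<^sup>2) ^ (n + Suc k) * (S (n + Suc k))\<^sup>2) sums ?T"
    using sums by (subst sums_zero_iff_shift) (auto simp: S_def low)
  have geo: "(\<lambda>n. (r\<^sup>2) ^ Suc k * (r\<^sup>2) ^ n) sums ((r\<^sup>2) ^ Suc k * (1 / (1 - r\<^sup>2)))"
    by (intro sums_mult geometric_sums) (use r in auto)
  have le: "\<bar>f (n + Suc k) * (r\<^sup>2) ^ (n + Suc k) * (S (n + Suc k))\<^sup>2\<bar> \<le> (r\<^sup>2) ^ Suc k * (r\<^sup>2) ^ n" for n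
  proof -
    have "\<bar>S (n + Suc k)\<bar> \<le> 1" unfolding S_def by (rule bound)
    then have "(S (n + Suc k))\<^sup>2 \<le> 1" by (simp add: abs_square_le_1)
    then have "\<bar>f (n + Suc k)\<bar> * (r\<^sup>2) ^ (n + Suc k) * (S (n + Suc k))\<^sup>2 \<le> 1 * (r\<^sup>2) ^ (n + Suc k) * 1"
      using f by (intro mult_mono) auto
    then show ?thesis by (simp add: abs_mult power_add mult_ac)
  qed
  have "\<bar>?T\<bar> = norm (\<Sum>n. f (n + Suc k) * (r\<^sup>2) ^ (n + Suc k) * (S (n + Suc k))\<^sup>2)"
    using shifted by (simp add: sums_iff)
  also have "\<dots> \<le> (\<Sum>n. (r\<^sup>2) ^ Suc k * (r\<^sup>2) ^ n)"
    using le geo by (intro norm_suminf_le) (auto simp: sums_iff)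
  also have "\<dots> = (r\<^sup>2) ^ Suc k * (1 / (1 - r\<^sup>2))"
    using geo by (simp add: sums_iff)
  also have "\<dots> \<le> (r\<^sup>2) ^ Suc k * 2"
    using r by (intro mult_left_mono) (auto simp: field_simps)
  also have "\<dots> = 2 * r ^ (2 * k + 2)"
  proof -
    have "2 * k + 2 = 2 * Suc k" by simp
    then show ?thesis by (simp only: power_mult mult.commute[of _ "2::real"])
  qed
  finally show ?thesis .
qed

text \<open>As functions of \<open>x\<close>, both sides are polynomials of degree at most
  \<open>k\<close> that agree at the \<open>k + 1\<close> nodes.\<close>

lemma lagrange_extrapolation:
  fixes b :: "nat \<Rightarrow> real"
  assumes b: "inj_on b {..k}" and n: "n \<le> k"
  shows "(\<Sum>j\<le>k. (\<Prod>l\<in>{..k} - {j}. (x - b l) / (b j - b l)) * b j ^ n) = x ^ n"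
proof -
  define L where "L j = (\<Prod>l\<in>{..k} - {j}. smult (1 / (b j - b l)) [:- b l, 1:])" for j
  have L: "poly (L j) y = (\<Prod>l\<in>{..k} - {j}. (y - b l) / (b j - b l))" for j y
    by (simp add: L_def poly_prod diff_divide_distrib)
  have deg: "degree (L j) \<le> k" if "j \<le> k" for j
  proof -
    have "degree (L j) \<le> (\<Sum>l\<in>{..k} - {j}. degree (smult (1 / (b j - b l)) [:- b l, 1:]))"
      unfolding L_def by (rule degree_prod_sum_le[unfolded o_def]) simp
    also have "\<dots> \<le> (\<Sum>l\<in>{..k} - {j}. 1)"
      by (intro sum_mono) simp
    also have "\<dots> = k" using that by simp
    finally show ?thesis .
  qed
  have delta: "poly (L j) (b i) = (if i = j then 1 else 0)" if "i \<le> k" "j \<le> k" for i j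
  proof (cases "i = j")
    case True
    have "poly (L j) (b j) = (\<Prod>l\<in>{..k} - {j}. 1)"
      unfolding L using b that by (intro prod.cong refl divide_self) (auto dest: inj_onD)
    with True show ?thesis by simp
  next
    case False
    then show ?thesis unfolding L using that by (auto intro!: prod_zero bexI[of _ i])
  qed
  define P where "P = (\<Sum>j\<le>k. smult (b j ^ n) (L j))"
  have "P = monom 1 n"
  proof (rule poly_eqI_degree[of "b ` {..k}"])
    fix y assume "y \<in> b ` {..k}"
    then obtain i where i: "i \<le> k" "y = b i" by auto
    have "poly P y = (\<Sum>j\<le>k. if j = i then b j ^ n else 0)"
      unfolding P_def poly_sum using i by (intro sum.cong refl) (auto simp: delta)
    then show "poly P y = poly (monom 1 n) y"
      using i by (simp add: poly_monom)
  next
    have "degree P \<le> k" unfolding P_def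
      by (intro degree_sum_le) (auto intro: order.trans[OF degree_smult_le] deg)
    then show "degree P < card (b ` {..k})" using b by (simp add: card_image)
    show "degree (monom (1::real) n) < card (b ` {..k})"
      using b n by (simp add: card_image degree_monom_eq)
  qed
  then have "poly P x = x ^ n" by (simp add: poly_monom)
  then show ?thesis by (simp add: P_def poly_sum L mult.commute)
qed

text \<open>Greedy choice: each function excludes at most \<open>m ^ r * (m\<^sup>2) ^ (m - r)\<close> of the \<open>(m\<^sup>2) ^ m\<close> functions.\<close>

lemma exists_code:
  assumes r: "0 < r" "r \<le> m"
  obtains C where "C \<subseteq> {..<m} \<rightarrow>\<^sub>E {..<m\<^sup>2}" "m ^ r \<le> card C"
    "\<And>f g. f \<in> C \<Longrightarrow> g \<in> C \<Longrightarrow> f \<noteq> g \<Longrightarrow> card {a \<in> {..<m}. f a = g a} < r"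
proof -
  define F where "F = ({..<m} \<rightarrow>\<^sub>E {..<m\<^sup>2})"
  define good where "good C \<longleftrightarrow> C \<subseteq> F \<and> (\<forall>f\<in>C. \<forall>g\<in>C. f \<noteq> g \<longrightarrow> card {a \<in> {..<m}. f a = g a} < r)" for C
  have finF: "finite F" unfolding F_def by (intro finite_PiE) auto
  have cardF: "card F = m ^ (2 * m)" unfolding F_def by (simp add: card_PiE power_mult)
  have "good {}" by (simp add: good_def)
  moreover have "\<forall>C. good C \<longrightarrow> card C < Suc (card F)"
    using finF by (auto simp: good_def less_Suc_eq_le intro: card_mono)
  ultimately obtain C where C: "good C" and max: "\<And>C'. good C' \<Longrightarrow> card C' \<le> card C"
    using ex_has_greatest_nat[of good "{}" card] by blast
  have finC: "finite C" using C finF by (auto simp: good_def intro: finite_subset)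
  define near where "near f = {g \<in> F. r \<le> card {a \<in> {..<m}. f a = g a}}" for f
  have near: "card (near f) \<le> m ^ r * m ^ (2 * (m - r))" if f: "f \<in> F" for f
  proof -
    define RR where "RR = {R. R \<subseteq> {..<m} \<and> card R = r}"
    define B where "B R = (\<Pi>\<^sub>E a\<in>{..<m}. if a \<in> R then {f a} else {..<m\<^sup>2})" for R
    have finB: "finite (B R)" for R unfolding B_def by (intro finite_PiE) auto
    have finRR: "finite RR" unfolding RR_def by simp
    \<comment> \<open>Agreement in at least \<open>r\<close> places means agreement on some set of
      exactly \<open>r\<close> places; \<open>B R\<close> collects the functions that copy
      \<open>f\<close> on \<open>R\<close> and are free elsewhere.\<close>
    have "near f \<subseteq> (\<Union>R\<in>RR. B R)"
    proof
      fix g assume g: "g \<in> near f"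
      then obtain R where R: "R \<subseteq> {a \<in> {..<m}. f a = g a}" "card R = r"
        using obtain_subset_with_card_n[of r "{a \<in> {..<m}. f a = g a}"] by (auto simp: near_def)
      then have "g \<in> B R" using g by (auto simp: B_def near_def F_def PiE_iff)
      moreover have "R \<in> RR" using R by (auto simp: RR_def)
      ultimately show "g \<in> (\<Union>R\<in>RR. B R)" by blast
    qed
    then have "card (near f) \<le> card (\<Union>R\<in>RR. B R)"
      using finB finRR by (intro card_mono) auto
    also have "\<dots> \<le> (\<Sum>R\<in>RR. card (B R))" using finRR by (rule card_UN_le)
    also have "\<dots> = (\<Sum>R\<in>RR. m ^ (2 * (m - r)))"
    proof (intro sum.cong refl)
      fix R assume R: "R \<in> RR"
      have "card (B R) = (\<Prod>a<m. if a \<in> R then 1 else m\<^sup>2)"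
        unfolding B_def by (simp add: card_PiE if_distrib cong: if_cong)
      also have "\<dots> = (\<Prod>a\<in>{..<m} - R. m\<^sup>2)"
        by (intro prod.mono_neutral_cong_right) auto
      also have "\<dots> = m ^ (2 * (m - r))"
        using R finite_subset[of R "{..<m}"] by (simp add: RR_def card_Diff_subset power_mult)
      finally show "card (B R) = m ^ (2 * (m - r))" .
    qed
    also have "\<dots> = (m choose r) * m ^ (2 * (m - r))"
      by (simp add: RR_def n_subsets)
    \<comment> \<open>The choice of \<open>R\<close> costs a factor of at most \<open>m ^ r\<close>,
      while fixing \<open>r\<close> values in an alphabet of size \<open>m^2\<close> gains
      \<open>m ^ (2 * r)\<close>. The surplus \<open>m ^ r\<close> is the size of the code.\<close>
    also have "\<dots> \<le> m ^ r * m ^ (2 * (m - r))"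
      by (intro mult_right_mono binomial_le_pow) (use r in auto)
    finally show ?thesis .
  qed
  \<comment> \<open>By maximality of \<open>C\<close>: a function near no member could be
    added.\<close>
  have "F \<subseteq> (\<Union>f\<in>C. near f)"
  proof
    fix g assume g: "g \<in> F"
    show "g \<in> (\<Union>f\<in>C. near f)"
    proof (rule ccontr)
      assume n: "g \<notin> (\<Union>f\<in>C. near f)"
      have "g \<notin> C"
      proof
        assume "g \<in> C"
        moreover have "g \<in> near g" using g r by (simp add: near_def)
        ultimately show False using n by blast
      qed
      moreover have "good (insert g C)"
      proof -
        have "card {a \<in> {..<m}. f a = g a} < r" if "f \<in> C" for f
          using n that g by (auto simp: near_def not_le)
        moreover from this have "card {a \<in> {..<m}. g a = f a} < r" if "f \<in> C" for f
          using that by (simp add: eq_commute[of "g _"])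
        ultimately show ?thesis using C g by (auto simp: good_def)
      qed
      ultimately show False using max[of "insert g C"] finC by simp
    qed
  qed
  then have "card F \<le> card (\<Union>f\<in>C. near f)"
    using finC finF by (intro card_mono) (auto simp: near_def)
  also have "\<dots> \<le> (\<Sum>f\<in>C. card (near f))" using finC by (rule card_UN_le)
  also have "\<dots> \<le> (\<Sum>f\<in>C. m ^ r * m ^ (2 * (m - r)))"
    using C by (intro sum_mono near) (auto simp: good_def)
  finally have "m ^ (2 * m) \<le> card C * (m ^ r * m ^ (2 * (m - r)))"
    by (simp add: cardF)
  moreover have "m ^ (2 * m) = m ^ r * (m ^ r * m ^ (2 * (m - r)))"
    using r by (simp flip: power_add add: algebra_simps)
  moreover have "m ^ r * m ^ (2 * (m - r)) > 0" using r by simp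
  ultimately have "m ^ r \<le> card C" by (metis mult_le_cancel2)
  with C show ?thesis by (intro that[of C]) (auto simp: good_def F_def)
qed

subsection \<open>Wedges under the Gaussian\<close>

lemma gaussian_integral_exp:
  assumes "c \<ge> 0" "sqlen d w = 1"
  shows "(LINT x|gaussian d. exp (- c * (dot d w x)\<^sup>2 / 2)) = 1 / sqrt (1 + c)"
  using gaussian_integral_exp_exp[of c 0 d w w] assms by simp

lemma gaussian_integrable_exp:
  assumes "c \<ge> 0"
  shows "integrable (gaussian d) (\<lambda>x. exp (- c * (dot d w x)\<^sup>2 / 2))"
proof -
  interpret G: prob_space "gaussian d" by (rule prob_space_gaussian)
  show ?thesis
    by (rule G.integrable_const_bound[where B = 1]) (use assms in \<open>auto simp: measurable_gaussian\<close>)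
qed

definition first_axis :: point where
  "first_axis i = of_bool (i = 0)"

lemma dot_first_axis: "0 < d \<Longrightarrow> dot d first_axis x = x 0"
  by (simp add: dot_def first_axis_def of_bool_def if_distrib if_distribR sum.delta cong: if_cong)

lemma exp_half_le: "exp (1 / 2 :: real) \<le> 2"
proof -
  have "exp (1 / 2 :: real) ^ 2 = exp 1" by (simp flip: exp_double)
  also have "\<dots> \<le> 2 ^ 2" using exp_le by simp
  finally show ?thesis by (rule power2_le_imp_le) simp
qed

text \<open>A Gaussian majorant, the constant 2 bounding exp(1/2). It replaces probabilities of
  slabs by integrals known in closed form.\<close>

lemma indicator_le_exp:
  fixes t s :: real
  assumes "s > 0"
  shows "of_bool (\<bar>t\<bar> \<le> s) \<le> 2 * exp (- (1 / s\<^sup>2) * t\<^sup>2 / 2)"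
proof (cases "\<bar>t\<bar> \<le> s")
  case True
  then have "t\<^sup>2 \<le> s\<^sup>2" using assms by (simp add: abs_le_square_iff[symmetric])
  then have "1 / s\<^sup>2 * t\<^sup>2 \<le> 1" using assms by (simp add: field_simps)
  then have "1 \<le> exp (1 / 2 + - (1 / s\<^sup>2) * t\<^sup>2 / 2)" unfolding one_le_exp_iff by simp
  also have "\<dots> = exp (1 / 2) * exp (- (1 / s\<^sup>2) * t\<^sup>2 / 2)" by (rule exp_add)
  also have "\<dots> \<le> 2 * exp (- (1 / s\<^sup>2) * t\<^sup>2 / 2)"
    by (intro mult_right_mono exp_half_le) simp
  finally show ?thesis using True by simp
qed simp

lemma exp_neg_le_inverse:
  fixes y :: real
  assumes "y > 0"
  shows "exp (- y) \<le> 1 / y"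
proof -
  have "y \<le> exp y" using exp_ge_add_one_self[of y] by linarith
  then show ?thesis using assms by (simp add: exp_minus inverse_eq_divide frac_le)
qed

text \<open>With \<open>s = sqrt \<gamma>\<close>, a point of the wedge lies in the slab of
  half-width \<open>s\<close> around the hyperplane of \<open>w\<close>, or its coordinate 0 exceeds
  \<open>1 / s\<close> in absolute value. The exponential majorants of the two events integrate to
  at most 2 s and s + 2 s.\<close>

lemma gaussian_wedge_small:
  assumes d: "0 < d" and g: "0 < \<gamma>" "\<gamma> \<le> 1" and w: "sqlen d w = 1"
  shows "measure (gaussian d) {x \<in> space (gaussian d). \<bar>dot d w x\<bar> \<le> \<gamma> * \<bar>x 0\<bar>} \<le> 5 * sqrt \<gamma>"
proof -
  interpret G: prob_space "gaussian d" by (rule prob_space_gaussian)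
  let ?W = "{x \<in> space (gaussian d). \<bar>dot d w x\<bar> \<le> \<gamma> * \<bar>x 0\<bar>}"
  define s where "s = sqrt \<gamma>"
  have s: "0 < s" "s \<le> 1" "\<gamma> = s * s" using g by (auto simp: s_def)
  let ?E = "\<lambda>c u x. exp (- c * (dot d u x)\<^sup>2 / 2)"
  let ?c = "1 / s\<^sup>2"
  have [measurable]: "dot d w \<in> borel_measurable (gaussian d)" "(\<lambda>x. x 0) \<in> borel_measurable (gaussian d)"
    using d by (simp_all add: measurable_gaussian component_measurable)
  have W: "?W \<in> sets (gaussian d)" by measurable
  have pw: "indicator ?W x \<le> 2 * ?E ?c w x + (1 - ?E s first_axis x) + exp (- (1 / s) / 2)" for x
  proof -
    \<comment> \<open>Beyond \<open>1 / s\<close> the exponential with coefficient \<open>s\<close>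
      has dropped below exp(-1/(2 s)), so its complement to 1 almost dominates the
      indicator.\<close>
    have tail: "of_bool (\<bar>x 0\<bar> > 1 / s) \<le> (1 - ?E s first_axis x) + exp (- (1 / s) / 2)"
    proof (cases "\<bar>x 0\<bar> > 1 / s")
      case True
      then have "(1 / s)\<^sup>2 \<le> (x 0)\<^sup>2" using s by (simp add: abs_le_square_iff[symmetric])
      then have "1 / s \<le> s * (x 0)\<^sup>2"
        using s by (simp add: field_simps power2_eq_square)
      then have "?E s first_axis x \<le> exp (- (1 / s) / 2)" using d by (simp add: dot_first_axis)
      with True show ?thesis by simp
    next
      case False
      have "?E s first_axis x \<le> 1" using s by simp
      with False show ?thesis by (simp add: add_nonneg_nonneg)
    qed
    have main: "of_bool (\<bar>dot d w x\<bar> \<le> s) \<le> 2 * ?E ?c w x"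
      by (rule indicator_le_exp) (rule s)
    have "indicator ?W x \<le> of_bool (\<bar>dot d w x\<bar> \<le> s) + (of_bool (\<bar>x 0\<bar> > 1 / s) :: real)"
    proof (cases "x \<in> ?W \<and> \<bar>x 0\<bar> \<le> 1 / s")
      case True
      then have "\<bar>dot d w x\<bar> \<le> \<gamma> * (1 / s)"
        using mult_left_mono[of "\<bar>x 0\<bar>" "1 / s" \<gamma>] g by auto
      with s show ?thesis by (simp split: split_indicator)
    qed (auto split: split_indicator)
    with tail main show ?thesis by linarith
  qed
  have int: "integrable (gaussian d) (?E c u)" if "c \<ge> 0" for c u
    by (rule gaussian_integrable_exp) fact
  have "measure (gaussian d) ?W = (LINT x|gaussian d. indicator ?W x)"
    using W by simp
  also have "\<dots> \<le> (LINT x|gaussian d. 2 * ?E ?c w x + (1 - ?E s first_axis x) + exp (- (1 / s) / 2))"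
  proof (rule integral_mono)
    show "integrable (gaussian d) (indicator ?W :: _ \<Rightarrow> real)"
      using W by (intro integrable_real_indicator) (auto simp: less_top[symmetric])
    show "integrable (gaussian d) (\<lambda>x. 2 * ?E ?c w x + (1 - ?E s first_axis x) + exp (- (1 / s) / 2))"
      using s by (intro Bochner_Integration.integrable_add Bochner_Integration.integrable_diff
        integrable_mult_right int G.integrable_const) auto
  qed (rule pw)
  also have "\<dots> = 2 * (LINT x|gaussian d. ?E ?c w x) + (1 - (LINT x|gaussian d. ?E s first_axis x)) + exp (- (1 / s) / 2)"
  proof -
    have "s \<ge> 0" using s by simp
    note [simp] = int[OF this, of first_axis] int[of ?c w, simplified]
    show ?thesis by (simp only: Bochner_Integration.integral_add Bochner_Integration.integral_diff
        integral_mult_right integrable_mult_right Bochner_Integration.integrable_add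
        Bochner_Integration.integrable_diff G.integrable_const int[OF \<open>s \<ge> 0\<close>] int zero_le_power2 zero_le_divide_1_iff)
        (simp add: G.prob_space)
  qed
  also have "\<dots> = 2 * (1 / sqrt (1 + ?c)) + (1 - 1 / sqrt (1 + s)) + exp (- (1 / s) / 2)"
  proof -
    have "(LINT x|gaussian d. ?E ?c w x) = 1 / sqrt (1 + ?c)"
      by (rule gaussian_integral_exp) (use w in auto)
    moreover have "(LINT x|gaussian d. ?E s first_axis x) = 1 / sqrt (1 + s)"
      by (rule gaussian_integral_exp) (use s d in \<open>auto simp: dot_first_axis first_axis_def\<close>)
    ultimately show ?thesis by (simp only:)
  qed
  also have "\<dots> \<le> 2 * s + s + 2 * s"
  proof (intro add_mono)
    have "1 / s \<le> sqrt (1 + ?c)" using s by (intro real_le_rsqrt) (simp add: power_divide)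
    then have "1 / sqrt (1 + ?c) \<le> 1 / (1 / s)" using s by (intro frac_le) auto
    then show "2 * (1 / sqrt (1 + ?c)) \<le> 2 * s" by simp
    have "1 + s \<le> (1 + s)\<^sup>2" using s self_le_power[of "1 + s" 2] by simp
    then have "sqrt (1 + s) \<le> 1 + s" using s by (intro real_le_lsqrt) auto
    then have "1 / (1 + s) \<le> 1 / sqrt (1 + s)" using s by (intro divide_left_mono) auto
    moreover have "1 - s \<le> 1 / (1 + s)"
    proof -
      have "(1 - s) * (1 + s) \<le> 1" using s by (simp add: algebra_simps)
      then show ?thesis using s by (subst pos_le_divide_eq) auto
    qed
    ultimately show "1 - 1 / sqrt (1 + s) \<le> s" by linarith
    show "exp (- (1 / s) / 2) \<le> 2 * s"
    proof -
      have "exp (- (1 / s / 2)) \<le> 1 / (1 / s / 2)" by (rule exp_neg_le_inverse) (use s in simp)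
      then show ?thesis by simp
    qed
  qed
  finally show ?thesis by (simp add: s_def)
qed

text \<open>The width h = s^2 / 16 is quadratic in \<open>s\<close> because the crude decay exp(-y)
  \<le> 1 / y has to beat the height 1 / h of the spike: it leaves 4 h / s^2 = 1/4.\<close>

lemma ratio_narrow_tail:
  assumes s: "0 < s" "s \<le> 1" and t: "\<bar>t\<bar> > s"
  shows "ratio ((s\<^sup>2 / 16)\<^sup>2) t \<le> 1 / 4"
proof -
  define h where "h = s\<^sup>2 / 16"
  have s2: "s\<^sup>2 \<le> 1" using s by (simp add: power_le_one)
  have h: "0 < h" "h \<le> 1" using s s2 by (auto simp: h_def)
  have "s\<^sup>2 \<le> t\<^sup>2" using s t by (simp add: abs_le_square_iff[symmetric])
  moreover have "1 / h\<^sup>2 - 1 \<ge> 0" using h by (simp add: power_le_one)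
  ultimately have le: "(1 / h\<^sup>2 - 1) * s\<^sup>2 \<le> (1 / h\<^sup>2 - 1) * t\<^sup>2" by (rule mult_left_mono)
  have "- (1 / h\<^sup>2 - 1) * t\<^sup>2 / 2 \<le> 1 / 2 - s\<^sup>2 / h\<^sup>2 / 2"
    using le s2 by (simp add: left_diff_distrib)
  then have "exp (- (1 / h\<^sup>2 - 1) * t\<^sup>2 / 2) \<le> exp (1 / 2 - s\<^sup>2 / h\<^sup>2 / 2)"
    by (simp del: mult_minus_left)
  also have "\<dots> = exp (1 / 2) * exp (- (s\<^sup>2 / h\<^sup>2 / 2))"
    by (simp flip: exp_add)
  also have "\<dots> \<le> 2 * (1 / (s\<^sup>2 / h\<^sup>2 / 2))"
    using s h by (intro mult_mono exp_half_le exp_neg_le_inverse) auto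
  also have "\<dots> = h / 4" using s h by (simp add: h_def power2_eq_square field_simps)
  finally show ?thesis using h unfolding ratio_def h_def[symmetric] by (simp add: field_simps)
qed

text \<open>The total mass 1 of the spike splits in three: the part in \<open>W\<close>, the part
  farther than \<open>\<gamma> / 8\<close> from the hyperplane of \<open>w\<close>, and the part
  with coordinate 0 at most 1/8 in absolute value. The last two are at most 1/4 each.
  \<open>W\<close> need not contain points with \<open>x 0 = 0\<close>, where the two concepts to be
  compared agree.\<close>

lemma narrow_wedge_large:
  assumes d: "0 < d" and g: "0 < \<gamma>" "\<gamma> \<le> 1" and w: "sqlen d w = 1" "w 0 = 0"
    and W: "W \<in> sets (gaussian d)"
      "\<And>x. x \<in> space (gaussian d) \<Longrightarrow> x 0 \<noteq> 0 \<Longrightarrow> \<bar>dot d w x\<bar> \<le> \<gamma> * \<bar>x 0\<bar> \<Longrightarrow> x \<in> W"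
  shows "1 / 2 \<le> (LINT x|gaussian d. indicator W x * ratio (((\<gamma> / 8)\<^sup>2 / 16)\<^sup>2) (dot d w x))"
proof -
  interpret G: prob_space "gaussian d" by (rule prob_space_gaussian)
  define s where "s = \<gamma> / 8"
  define a where "a = (s\<^sup>2 / 16)\<^sup>2"
  have s: "0 < s" "s \<le> 1" using g by (auto simp: s_def)
  have a: "a \<in> {0<..1}"
    using s power_le_one[of s 2] by (auto simp: a_def intro!: power_le_one)
  let ?r = "\<lambda>x. ratio a (dot d w x)"
  \<comment> \<open>Chosen so that \<open>1 / ?b - 1\<close> is 64, the coefficient in the majorant
    of the slab of half-width 1/8. That majorant is then a multiple of a ratio along the first axis,
    and orthogonality to \<open>w\<close> makes the mixed integral equal to 1.\<close>
  let ?b = "1 / 65 :: real"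
  have r: "?r x > 0" for x using a ratio_pos by simp
  have [measurable]: "dot d w \<in> borel_measurable (gaussian d)"
    using d by (simp add: measurable_gaussian)
  have pw: "?r x \<le> indicator W x * ?r x + 1 / 4 + 2 * sqrt ?b * (?r x * ratio ?b (dot d first_axis x))"
    if x: "x \<in> space (gaussian d)" for x
  proof -
    have "ratio ?b (dot d first_axis x) > 0" by (rule ratio_pos) simp
    then have nn: "2 * sqrt ?b * (?r x * ratio ?b (dot d first_axis x)) \<ge> 0" using r[of x] by simp
    consider "x \<in> W" | "\<bar>dot d w x\<bar> > s" | "\<bar>x 0\<bar> \<le> 1 / 8"
    proof -
      have "x \<in> W" if "\<bar>dot d w x\<bar> \<le> s" "\<bar>x 0\<bar> > 1 / 8"
      proof (rule W(2)[OF x])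
        show "x 0 \<noteq> 0" using that by auto
        have "\<gamma> * (1 / 8) \<le> \<gamma> * \<bar>x 0\<bar>" using that g by (intro mult_left_mono) auto
        then show "\<bar>dot d w x\<bar> \<le> \<gamma> * \<bar>x 0\<bar>" using that by (simp add: s_def)
      qed
      then show ?thesis using that by (meson not_le)
    qed
    then show ?thesis
    proof cases
      case 1 then show ?thesis using nn by simp
    next
      case 2
      have "?r x \<le> 1 / 4" unfolding a_def by (rule ratio_narrow_tail) fact+
      moreover have "indicator W x * ?r x \<ge> 0" using r[of x] by simp
      ultimately show ?thesis using nn by linarith
    next
      case 3
      have "1 \<le> 2 * exp (- 64 * (x 0)\<^sup>2 / 2)"
        using indicator_le_exp[of "1 / 8" "x 0"] 3 by (simp add: power2_eq_square)
      also have "\<dots> = 2 * sqrt ?b * ratio ?b (dot d first_axis x)"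
        using d by (simp add: ratio_def dot_first_axis)
      finally have "?r x * 1 \<le> ?r x * (2 * sqrt ?b * ratio ?b (dot d first_axis x))"
        using r[of x] by (intro mult_left_mono) auto
      moreover have "indicator W x * ?r x \<ge> 0" using r[of x] by simp
      ultimately show ?thesis by (simp add: mult_ac)
    qed
  qed
  have int: "integrable (gaussian d) ?r" by (rule ratio_integrable) fact
  have intW: "integrable (gaussian d) (\<lambda>x. indicator W x * ?r x)"
    using integrable_mult_indicator[OF W(1) int] by simp
  have intp: "integrable (gaussian d) (\<lambda>x. ?r x * ratio ?b (dot d first_axis x))"
    by (rule ratio_prod_integrable) (use a in auto)
  have ax: "sqlen d first_axis = 1" "dot d w first_axis = 0"
    using dot_first_axis[OF d, of first_axis] dot_first_axis[OF d, of w] dot_commute[of d w first_axis] w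
    by (simp_all add: first_axis_def)
  have "1 = (LINT x|gaussian d. ?r x)" using ratio_integral[OF a w(1)] by simp
  also have "\<dots> \<le> (LINT x|gaussian d. indicator W x * ?r x + 1 / 4 + 2 * sqrt ?b * (?r x * ratio ?b (dot d first_axis x)))"
    by (intro integral_mono int Bochner_Integration.integrable_add intW integrable_mult_right intp pw) auto
  also have "\<dots> = (LINT x|gaussian d. indicator W x * ?r x) + 1 / 4 +
      2 * sqrt ?b * (LINT x|gaussian d. ?r x * ratio ?b (dot d first_axis x))"
    using intW intp by (simp add: G.prob_space)
  also have "(LINT x|gaussian d. ?r x * ratio ?b (dot d first_axis x)) = 1"
    using ratio_correlation[of a ?b d w first_axis] a w ax by simp
  also have "2 * sqrt ?b * 1 \<le> 1 / 4"
  proof -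
    have "sqrt ?b \<le> 1 / 8" by (rule real_le_lsqrt) (auto simp: power2_eq_square)
    then show ?thesis by simp
  qed
  finally show ?thesis by (simp add: a_def s_def)
qed

subsection \<open>The hard distributions\<close>

lemma integral_double_sum:
  fixes f :: "'b \<Rightarrow> 'c \<Rightarrow> 'a \<Rightarrow> real"
  assumes f: "\<And>v w. v \<in> S \<Longrightarrow> w \<in> T \<Longrightarrow> integrable M (f v w)"
  shows "(LINT x|M. (\<Sum>v\<in>S. \<Sum>w\<in>T. c v w * f v w x)) = (\<Sum>v\<in>S. \<Sum>w\<in>T. c v w * (LINT x|M. f v w x))"
proof -
  have "(LINT x|M. (\<Sum>v\<in>S. \<Sum>w\<in>T. c v w * f v w x)) = (\<Sum>v\<in>S. LINT x|M. (\<Sum>w\<in>T. c v w * f v w x))"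
    by (rule Bochner_Integration.integral_sum)
       (intro Bochner_Integration.integrable_sum integrable_mult_right f)
  also have "\<dots> = (\<Sum>v\<in>S. \<Sum>w\<in>T. LINT x|M. c v w * f v w x)"
    by (intro sum.cong refl Bochner_Integration.integral_sum integrable_mult_right f)
  finally show ?thesis by simp
qed

text \<open>A bound for the sum of the absolute Lagrange coefficients when extrapolating from
  \<open>k + 1\<close> nodes with spacing \<open>1 / (2 * Suc k)\<close> to a point of the unit
  interval: each coefficient has \<open>k\<close> factors, with numerators at most 1 and
  denominators at least the spacing.\<close>

definition extrapolation_const :: "nat \<Rightarrow> real" where
  "extrapolation_const k = real (Suc k) * (2 * real (Suc k)) ^ k"

text \<open>A node is 1 minus a variance. Those up to \<open>k\<close> stay below 1/2, so their
  ratios are bounded independently of \<open>h\<close>; index \<open>Suc k\<close> is the spike, of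
  variance \<open>h^2\<close>.\<close>

definition node :: "nat \<Rightarrow> real \<Rightarrow> nat \<Rightarrow> real" where
  "node k h j = (if j \<le> k then real j / (2 * real (Suc k)) else 1 - h\<^sup>2)"

text \<open>The spike has weight 1 before normalisation and the others cancel its powers. The
  denominator makes the compensating weights sum to at most 1/2 in absolute value, which keeps the
  tilted density nonnegative; the price is that the spike has mass only
  \<open>1 / (2 * extrapolation_const k)\<close>.\<close>

definition node_weight :: "nat \<Rightarrow> real \<Rightarrow> nat \<Rightarrow> real" where
  "node_weight k h j =
    (if j \<le> k then - (\<Prod>l\<in>{..k} - {j}. (1 - h\<^sup>2 - node k h l) / (node k h j - node k h l)) else 1)
      / (2 * extrapolation_const k)"

text \<open>The relative density of \<open>A - N(0, 1)\<close>, where \<open>A\<close> has a spike of width \<open>h\<close> at \<open>0\<close> and matches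
  the moments of \<open>N(0, 1)\<close> up to degree \<open>2 * k + 1\<close>. A normal distribution of variance \<open>1 - b\<close> has
  its moments up to that degree determined by \<open>b ^ n\<close>, \<open>n \<le> k\<close>, so compensating the spike is
  extrapolation from the nodes to \<open>b = 1 - h\<^sup>2\<close>.\<close>

definition bump :: "nat \<Rightarrow> real \<Rightarrow> real \<Rightarrow> real" where
  "bump k h t = (\<Sum>j\<le>Suc k. node_weight k h j * ratio (1 - node k h j) t)"

definition tilted :: "nat \<Rightarrow> nat \<Rightarrow> real \<Rightarrow> point \<Rightarrow> point measure" where
  "tilted d k h w = density (gaussian d) (\<lambda>x. ennreal (1 + bump k h (dot d w x)))"

lemma extrapolation_const_ge_1: "extrapolation_const k \<ge> 1"
proof -
  have "1 * 1 \<le> real (Suc k) * (2 * real (Suc k)) ^ k"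
    by (intro mult_mono one_le_power) auto
  then show ?thesis by (simp add: extrapolation_const_def)
qed

lemma node_range:
  assumes "0 < h" "h \<le> 1"
  shows "0 \<le> node k h j" "node k h j < 1" "j \<le> k \<Longrightarrow> node k h j \<le> 1 / 2"
proof -
  have "j \<le> k \<Longrightarrow> node k h j \<le> 1 / 2" for j
    by (auto simp: node_def field_simps)
  then show "j \<le> k \<Longrightarrow> node k h j \<le> 1 / 2" .
  then show "node k h j < 1" using assms by (cases "j \<le> k") (auto simp: node_def)
  show "0 \<le> node k h j" using assms power_le_one[of h 2] by (auto simp: node_def)
qed

lemma node_variance:
  assumes "0 < h" "h \<le> 1"
  shows "1 - node k h j \<in> {0<..1}"
  using node_range[OF assms, of k j] by auto

lemma node_weight_low_powers:
  assumes n: "n \<le> k"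
  shows "(\<Sum>j\<le>Suc k. node_weight k h j * node k h j ^ n) = 0"
proof -
  have inj: "inj_on (node k h) {..k}"
    by (auto simp: inj_on_def node_def field_simps)
  let ?L = "\<lambda>j. \<Prod>l\<in>{..k} - {j}. (1 - h\<^sup>2 - node k h l) / (node k h j - node k h l)"
  have "(\<Sum>j\<le>k. node_weight k h j * node k h j ^ n) =
      - (\<Sum>j\<le>k. ?L j * node k h j ^ n) / (2 * extrapolation_const k)"
    by (simp add: node_weight_def sum_negf sum_divide_distrib cong: sum.cong_simp)
  also have "(\<Sum>j\<le>k. ?L j * node k h j ^ n) = (1 - h\<^sup>2) ^ n"
    by (rule lagrange_extrapolation[OF inj n])
  finally show ?thesis
    by (simp add: node_weight_def) (simp add: node_def)
qed

lemma node_weight_abs_sum: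
  assumes h: "0 < h" "h \<le> 1"
  shows "(\<Sum>j\<le>k. \<bar>node_weight k h j\<bar>) \<le> 1 / 2"
proof -
  have L: "\<bar>node_weight k h j\<bar> \<le> (2 * real (Suc k)) ^ k / (2 * extrapolation_const k)" if j: "j \<le> k" for j
  proof -
    have "\<bar>\<Prod>l\<in>{..k} - {j}. (1 - h\<^sup>2 - node k h l) / (node k h j - node k h l)\<bar> \<le>
        (\<Prod>l\<in>{..k} - {j}. 2 * real (Suc k))"
      unfolding abs_prod
    proof (intro prod_mono conjI abs_ge_zero)
      fix l assume l: "l \<in> {..k} - {j}"
      have "\<bar>real j - real l\<bar> \<ge> 1" using l by auto
      then have den: "\<bar>node k h j - node k h l\<bar> \<ge> 1 / (2 * real (Suc k))"
        using l j by (simp add: node_def flip: diff_divide_distrib) (simp add: divide_right_mono)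
      have num: "\<bar>1 - h\<^sup>2 - node k h l\<bar> \<le> 1"
        using node_range(1,2)[OF h, of k l] h power_le_one[of h 2] zero_le_power2[of h] by linarith
      have "\<bar>(1 - h\<^sup>2 - node k h l) / (node k h j - node k h l)\<bar> \<le> 1 / (1 / (2 * real (Suc k)))"
        unfolding abs_divide by (intro frac_le num den) auto
      then show "\<bar>(1 - h\<^sup>2 - node k h l) / (node k h j - node k h l)\<bar> \<le> 2 * real (Suc k)"
        by simp
    qed
    also have "\<dots> = (2 * real (Suc k)) ^ k" using j by simp
    finally show ?thesis
      using j extrapolation_const_ge_1[of k]
      by (simp add: node_weight_def abs_divide divide_right_mono)
  qed
  have "(\<Sum>j\<le>k. \<bar>node_weight k h j\<bar>) \<le> (\<Sum>j\<le>k. (2 * real (Suc k)) ^ k / (2 * extrapolation_const k))"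
    by (intro sum_mono L) simp
  also have "\<dots> = extrapolation_const k / (2 * extrapolation_const k)"
    by (simp add: extrapolation_const_def)
  also have "\<dots> = 1 / 2" using extrapolation_const_ge_1[of k] by simp
  finally show ?thesis .
qed

lemma node_weight_power_bound:
  assumes h: "0 < h" "h \<le> 1"
  shows "\<bar>\<Sum>j\<le>Suc k. node_weight k h j * node k h j ^ n\<bar> \<le> 1"
proof -
  have "\<bar>\<Sum>j\<le>Suc k. node_weight k h j * node k h j ^ n\<bar> \<le> (\<Sum>j\<le>Suc k. \<bar>node_weight k h j\<bar> * 1)"
  proof (rule order.trans[OF sum_abs], rule sum_mono)
    fix j
    show "\<bar>node_weight k h j * node k h j ^ n\<bar> \<le> \<bar>node_weight k h j\<bar> * 1"
      using node_range[OF h, of k j] unfolding abs_mult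
      by (intro mult_left_mono) (auto simp: power_le_one)
  qed
  also have "\<dots> = (\<Sum>j\<le>k. \<bar>node_weight k h j\<bar>) + 1 / (2 * extrapolation_const k)"
    using extrapolation_const_ge_1[of k] by (simp add: node_weight_def)
  also have "\<dots> \<le> 1 / 2 + 1 / 2"
    using extrapolation_const_ge_1[of k] by (intro add_mono node_weight_abs_sum h) simp
  finally show ?thesis by simp
qed

lemma bump_measurable [measurable]: "bump k h \<in> borel_measurable borel"
  unfolding bump_def by measurable

text \<open>The compensating ratios are at most 2 and their weights sum to at most 1/2 in absolute
  value. Hence adding 1 to the bump outweighs all compensation and leaves at least the
  spike.\<close>

lemma bump_near_spike:
  assumes h: "0 < h" "h \<le> 1"
  shows "\<bar>bump k h t - ratio (h\<^sup>2) t / (2 * extrapolation_const k)\<bar> \<le> 1"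
proof -
  have "\<bar>\<Sum>j\<le>k. node_weight k h j * ratio (1 - node k h j) t\<bar> \<le> (\<Sum>j\<le>k. \<bar>node_weight k h j\<bar> * 2)"
  proof (rule order.trans[OF sum_abs], rule sum_mono)
    fix j assume j: "j \<in> {..k}"
    have "1 / 4 \<le> 1 - node k h j" using node_range(3)[OF h, of j k] j by simp
    then have "sqrt (1 / 4) \<le> sqrt (1 - node k h j)" by (simp only: real_sqrt_le_iff)
    then have "1 / sqrt (1 - node k h j) \<le> 1 / (1 / 2)"
      by (intro frac_le) (auto simp: real_sqrt_divide)
    then have "\<bar>ratio (1 - node k h j) t\<bar> \<le> 2"
      using ratio_le[OF node_variance[OF h], of k j t] ratio_pos[of "1 - node k h j" t] node_variance[OF h, of k j]
      by auto
    then show "\<bar>node_weight k h j * ratio (1 - node k h j) t\<bar> \<le> \<bar>node_weight k h j\<bar> * 2"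
      unfolding abs_mult by (intro mult_left_mono) auto
  qed
  also have "\<dots> \<le> 1 / 2 * 2"
    unfolding sum_distrib_right[symmetric] by (intro mult_right_mono node_weight_abs_sum h) simp
  finally have "\<bar>\<Sum>j\<le>k. node_weight k h j * ratio (1 - node k h j) t\<bar> \<le> 1" by simp
  moreover have "bump k h t = (\<Sum>j\<le>k. node_weight k h j * ratio (1 - node k h j) t) +
      ratio (h\<^sup>2) t / (2 * extrapolation_const k)"
    unfolding bump_def by (simp add: node_weight_def node_def)
  ultimately show ?thesis by simp
qed

lemma bump_ge:
  assumes h: "0 < h" "h \<le> 1"
  shows "ratio (h\<^sup>2) t / (2 * extrapolation_const k) \<le> 1 + bump k h t"
  using bump_near_spike[OF assms, of k t] by linarith

lemma bump_ge_neg_1: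
  assumes h: "0 < h" "h \<le> 1"
  shows "0 \<le> 1 + bump k h t"
  using order.trans[OF _ bump_ge[OF h, of t k], of 0] ratio_pos[of "h\<^sup>2" t] h extrapolation_const_ge_1[of k]
  by simp

text \<open>The uniform bound for the Cauchy-Schwarz argument: the size of the family has to
  outweigh the square of \<open>2 / h\<close>.\<close>

lemma bump_abs_le:
  assumes h: "0 < h" "h \<le> 1"
  shows "\<bar>bump k h t\<bar> \<le> 2 / h"
proof -
  have "ratio (h\<^sup>2) t / (2 * extrapolation_const k) \<le> (1 / h) / 1"
    using ratio_le[of "h\<^sup>2" t] h power_le_one[of h 2] extrapolation_const_ge_1[of k]
    by (intro frac_le) auto
  moreover have "0 \<le> ratio (h\<^sup>2) t / (2 * extrapolation_const k)"
    using ratio_pos[of "h\<^sup>2" t] h extrapolation_const_ge_1[of k] by simp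
  moreover have "1 \<le> 1 / h" using h by simp
  moreover have "2 / h = 1 / h + 1 / h" by simp
  ultimately show ?thesis using bump_near_spike[OF h, of k t] by linarith
qed

lemma bump_integrable:
  assumes h: "0 < h" "h \<le> 1"
  shows "integrable (gaussian d) (\<lambda>x. bump k h (dot d w x))"
  unfolding bump_def by (intro Bochner_Integration.integrable_sum integrable_mult_right ratio_integrable node_variance h)

lemma bump_integral:
  assumes h: "0 < h" "h \<le> 1" and w: "sqlen d w = 1"
  shows "(LINT x|gaussian d. bump k h (dot d w x)) = 0"
proof -
  have "(LINT x|gaussian d. bump k h (dot d w x)) =
      (\<Sum>j\<le>Suc k. node_weight k h j * (LINT x|gaussian d. ratio (1 - node k h j) (dot d w x)))"
    unfolding bump_def
    by (subst Bochner_Integration.integral_sum)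
       (intro integrable_mult_right ratio_integrable node_variance h, simp)
  also have "\<dots> = (\<Sum>j\<le>Suc k. node_weight k h j * node k h j ^ 0)"
    by (intro sum.cong refl) (simp add: ratio_integral[OF node_variance[OF h] w])
  also have "\<dots> = 0" by (rule node_weight_low_powers) simp
  finally show ?thesis .
qed

text \<open>Bilinear expansion turns the correlation into the quadratic form of 1 / sqrt(1 - r^2 b
  b') in the node weights. Their power sums vanish up to order \<open>k\<close>, so the first
  surviving term has order \<open>Suc k\<close> in r^2.\<close>

lemma bump_correlation:
  assumes h: "0 < h" "h \<le> 1" and w: "sqlen d w = 1" "sqlen d w' = 1"
    and r: "(dot d w w')\<^sup>2 \<le> 1 / 2"
  shows "\<bar>(LINT x|gaussian d. bump k h (dot d w x) * bump k h (dot d w' x))\<bar> \<le> 2 * dot d w w' ^ (2 * k + 2)"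
proof -
  have "(LINT x|gaussian d. bump k h (dot d w x) * bump k h (dot d w' x)) =
      (LINT x|gaussian d. (\<Sum>i\<le>Suc k. \<Sum>j\<le>Suc k. (node_weight k h i * node_weight k h j) *
        (ratio (1 - node k h i) (dot d w x) * ratio (1 - node k h j) (dot d w' x))))"
    unfolding bump_def sum_product by (simp only: mult_ac)
  also have "\<dots> = (\<Sum>i\<le>Suc k. \<Sum>j\<le>Suc k. (node_weight k h i * node_weight k h j) *
        (LINT x|gaussian d. ratio (1 - node k h i) (dot d w x) * ratio (1 - node k h j) (dot d w' x)))"
    by (intro integral_double_sum ratio_prod_integrable node_variance h)
  also have "\<dots> = (\<Sum>i\<le>Suc k. \<Sum>j\<le>Suc k. node_weight k h i * node_weight k h j /
        sqrt (1 - (dot d w w')\<^sup>2 * node k h i * node k h j))"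
    using r by (intro sum.cong refl) (simp add: ratio_correlation[OF node_variance[OF h] node_variance[OF h] w])
  also have "\<bar>\<dots>\<bar> \<le> 2 * dot d w w' ^ (2 * k + 2)"
  proof (rule inverse_sqrt_quadratic_form_bound)
    show "\<bar>node k h j\<bar> \<le> 1" for j using node_range[OF h, of k j] by simp
  qed (use r node_weight_low_powers node_weight_power_bound[OF h] in auto)
  finally show ?thesis .
qed

section \<open>Tilted distributions and the mass of a wedge\<close>

lemma integral_tilted:
  assumes h: "0 < h" "h \<le> 1" and f: "f \<in> borel_measurable (euclid d)"
  shows "(LINT x|tilted d k h w. f x) = (LINT x|gaussian d. (1 + bump k h (dot d w x)) * f x)"
  unfolding tilted_def
  by (subst integral_density) (use f bump_ge_neg_1[OF h] in \<open>auto simp: measurable_gaussian\<close>)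

lemma sets_tilted: "sets (tilted d k h w) = sets (euclid d)"
  by (simp add: tilted_def sets_gaussian)

lemma space_tilted: "space (tilted d k h w) = space (euclid d)"
  by (simp add: tilted_def space_gaussian)

lemma test_distribution_tilted:
  assumes h: "0 < h" "h \<le> 1" and w: "sqlen d w = 1"
  shows "test_distribution d (tilted d k h w)"
proof -
  interpret G: prob_space "gaussian d" by (rule prob_space_gaussian)
  have m: "(\<lambda>x. ennreal (1 + bump k h (dot d w x))) \<in> borel_measurable (gaussian d)"
    by (simp add: measurable_gaussian)
  have "emeasure (tilted d k h w) (space (tilted d k h w)) = (\<integral>\<^sup>+x. ennreal (1 + bump k h (dot d w x)) \<partial>gaussian d)"
    unfolding tilted_def using m
    by (subst emeasure_density) (auto intro!: nn_integral_cong simp: indicator_def)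
  also have "\<dots> = ennreal (LINT x|gaussian d. 1 + bump k h (dot d w x))"
    using bump_integrable[OF h] bump_ge_neg_1[OF h] by (intro nn_integral_eq_integral) auto
  also have "(LINT x|gaussian d. 1 + bump k h (dot d w x)) = 1"
    using bump_integrable[OF h, of d k w] bump_integral[OF h w, of k] by (simp add: G.prob_space)
  finally have "prob_space (tilted d k h w)" by (intro prob_spaceI) simp
  then show ?thesis by (simp add: test_distribution_def sets_tilted)
qed

text \<open>The tilted density is at least its spike part, of mass
  \<open>1 / (2 * extrapolation_const k)\<close>, and at least half of the spike lies in the
  wedge.\<close>

lemma tilted_wedge:
  assumes d: "0 < d" and g: "0 < \<gamma>" "\<gamma> \<le> 1" and h: "h = (\<gamma> / 8)\<^sup>2 / 16"
    and w: "sqlen d w = 1" "w 0 = 0"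
    and W: "W \<in> sets (euclid d)"
      "\<And>x. x \<in> space (euclid d) \<Longrightarrow> x 0 \<noteq> 0 \<Longrightarrow> \<bar>dot d w x\<bar> \<le> \<gamma> * \<bar>x 0\<bar> \<Longrightarrow> x \<in> W"
  shows "1 / (4 * extrapolation_const k) \<le> measure (tilted d k h w) W"
proof -
  let ?L = "extrapolation_const k"
  have h01: "0 < h" "h \<le> 1"
    using g power_le_one[of "\<gamma> / 8" 2] by (auto simp: h)
  interpret T: prob_space "tilted d k h w"
    using test_distribution_tilted[OF h01 w(1)] by (simp add: test_distribution_def)
  have a: "h\<^sup>2 \<in> {0<..1}" using h01 by (simp add: power_le_one)
  have WG: "W \<in> sets (gaussian d)" using W by (simp add: sets_gaussian)
  have "1 / (4 * ?L) = 1 / 2 / (2 * ?L)" by simp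
  also have "\<dots> \<le> (LINT x|gaussian d. indicator W x * ratio (h\<^sup>2) (dot d w x)) / (2 * ?L)"
    using narrow_wedge_large[OF d g w WG] W(2) extrapolation_const_ge_1[of k]
    by (intro divide_right_mono) (auto simp: h space_gaussian)
  also have "\<dots> = (LINT x|gaussian d. indicator W x * ratio (h\<^sup>2) (dot d w x) / (2 * ?L))"
    by simp
  also have "\<dots> \<le> (LINT x|gaussian d. (1 + bump k h (dot d w x)) * indicator W x)"
  proof (rule integral_mono)
    have "integrable (gaussian d) (\<lambda>x. indicator W x * ratio (h\<^sup>2) (dot d w x))"
      using integrable_mult_indicator[OF WG ratio_integrable[OF a, of d w]] by simp
    then show "integrable (gaussian d) (\<lambda>x. indicator W x * ratio (h\<^sup>2) (dot d w x) / (2 * ?L))"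
      by (rule integrable_divide)
    interpret G: prob_space "gaussian d" by (rule prob_space_gaussian)
    have "integrable (gaussian d) (\<lambda>x. 1 + bump k h (dot d w x))"
      using bump_integrable[OF h01] by simp
    from integrable_mult_indicator[OF WG this]
    show "integrable (gaussian d) (\<lambda>x. (1 + bump k h (dot d w x)) * indicator W x)"
      by (simp add: mult.commute)
    show "indicator W x * ratio (h\<^sup>2) (dot d w x) / (2 * ?L) \<le> (1 + bump k h (dot d w x)) * indicator W x" for x
      using bump_ge[OF h01, of "dot d w x" k] by (auto split: split_indicator)
  qed
  also have "\<dots> = (LINT x|tilted d k h w. indicator W x)"
    using W(1) by (intro integral_tilted[symmetric] h01) auto
  also have "\<dots> = measure (tilted d k h w) W"
    using W(1) by (simp add: sets_tilted)
  finally show ?thesis .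
qed

section \<open>One query against a nearly orthogonal family\<close>

lemma (in prob_space) square_expectation_le:
  fixes X :: "'a \<Rightarrow> real"
  assumes "X \<in> borel_measurable M" "\<And>x. x \<in> space M \<Longrightarrow> \<bar>X x\<bar> \<le> B"
  shows "(expectation X)\<^sup>2 \<le> expectation (\<lambda>x. (X x)\<^sup>2)"
proof -
  have "integrable M X"
    by (rule integrable_const_bound[where B = B]) (use assms in auto)
  moreover have "integrable M (\<lambda>x. (X x)\<^sup>2)"
  proof (rule integrable_const_bound[where B = "B\<^sup>2"])
    show "AE x in M. norm ((X x)\<^sup>2) \<le> B\<^sup>2"
    proof (rule AE_I2)
      fix x assume "x \<in> space M"
      then have "\<bar>X x\<bar> \<le> \<bar>B\<bar>" using assms(2) by force
      then show "norm ((X x)\<^sup>2) \<le> B\<^sup>2" by (simp add: abs_le_square_iff)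
    qed
  qed (use assms in auto)
  ultimately show ?thesis using variance_eq[of X] variance_positive[of X] by simp
qed

text \<open>Cauchy--Schwarz for the sum of the \<open>g w\<close>, each taken with the sign of its correlation with \<open>q\<close>.\<close>

lemma (in prob_space) nearly_orthogonal_correlation_bound:
  fixes g :: "'b \<Rightarrow> 'a \<Rightarrow> real" and q :: "'a \<Rightarrow> real"
  assumes S: "finite S"
    and g: "\<And>w. w \<in> S \<Longrightarrow> g w \<in> borel_measurable M" "\<And>w x. w \<in> S \<Longrightarrow> \<bar>g w x\<bar> \<le> B"
    and orth: "\<And>v w. v \<in> S \<Longrightarrow> w \<in> S \<Longrightarrow> v \<noteq> w \<Longrightarrow> \<bar>expectation (\<lambda>x. g v x * g w x)\<bar> \<le> \<tau>"
    and q: "q \<in> borel_measurable M" "\<And>x. x \<in> space M \<Longrightarrow> \<bar>q x\<bar> \<le> 1"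
    and corr: "\<And>w. w \<in> S \<Longrightarrow> \<phi> \<le> \<bar>expectation (\<lambda>x. q x * g w x)\<bar>" and \<phi>: "0 \<le> \<phi>" "\<tau> \<ge> 0"
  shows "real (card S) * (\<phi>\<^sup>2 - \<tau>) \<le> B\<^sup>2"
proof (cases "S = {}")
  case False
  define \<sigma> where "\<sigma> w = sgn (expectation (\<lambda>x. q x * g w x))" for w
  define X where "X x = (\<Sum>w\<in>S. \<sigma> w * g w x)" for x
  let ?n = "real (card S)"
  have n: "?n > 0" using False S by (simp add: card_gt_0_iff)
  have \<sigma>: "\<bar>\<sigma> w\<bar> \<le> 1" for w by (simp add: \<sigma>_def sgn_if)
  have B: "0 \<le> B" using False g(2) by (meson abs_ge_zero all_not_in_conv order.trans)
  have [measurable]: "X \<in> borel_measurable M"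
    unfolding X_def by (intro borel_measurable_sum borel_measurable_times borel_measurable_const g(1))
  have Xb: "\<bar>X x\<bar> \<le> ?n * B" for x
  proof -
    have "\<bar>\<sigma> w * g w x\<bar> \<le> 1 * B" if "w \<in> S" for w
      unfolding abs_mult by (intro mult_mono \<sigma> g(2) that) auto
    then have "\<bar>X x\<bar> \<le> (\<Sum>w\<in>S. 1 * B)"
      unfolding X_def by (intro order.trans[OF sum_abs] sum_mono) auto
    then show ?thesis by simp
  qed
  have intq: "integrable M (\<lambda>x. q x * g w x)" if "w \<in> S" for w
  proof (rule integrable_const_bound[where B = "1 * B"])
    show "AE x in M. norm (q x * g w x) \<le> 1 * B"
      unfolding real_norm_def abs_mult by (intro AE_I2 mult_mono q(2) g(2) that) auto
  qed (use q(1) g(1)[OF that] in auto)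
  have intg: "integrable M (\<lambda>x. g v x * g w x)" if "v \<in> S" "w \<in> S" for v w
  proof (rule integrable_const_bound[where B = "B * B"])
    show "AE x in M. norm (g v x * g w x) \<le> B * B"
      unfolding real_norm_def abs_mult by (intro AE_I2 mult_mono g(2) that B) auto
  qed (use g(1) that in auto)
  have "?n * \<phi> \<le> (\<Sum>w\<in>S. \<bar>expectation (\<lambda>x. q x * g w x)\<bar>)"
    using sum_mono[of S "\<lambda>_. \<phi>", OF corr] by simp
  also have "\<dots> = (\<Sum>w\<in>S. expectation (\<lambda>x. \<sigma> w * (q x * g w x)))"
    by (intro sum.cong refl) (simp add: \<sigma>_def abs_sgn mult.commute)
  also have "\<dots> = expectation (\<lambda>x. q x * X x)"
    unfolding X_def sum_distrib_left
    by (subst Bochner_Integration.integral_sum) (auto intro: intq simp: mult_ac)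
  finally have "(?n * \<phi>)\<^sup>2 \<le> (expectation (\<lambda>x. q x * X x))\<^sup>2"
    using \<phi> by (intro power_mono) auto
  also have "\<dots> \<le> expectation (\<lambda>x. (q x * X x)\<^sup>2)"
  proof (rule square_expectation_le)
    show "\<bar>q x * X x\<bar> \<le> 1 * (?n * B)" if "x \<in> space M" for x
      using q(2)[OF that] Xb[of x] unfolding abs_mult by (intro mult_mono) auto
  qed (use q in auto)
  also have "\<dots> \<le> expectation (\<lambda>x. (X x)\<^sup>2)"
  proof (rule integral_mono_AE')
    show "integrable M (\<lambda>x. (X x)\<^sup>2)"
    proof (rule integrable_const_bound[where B = "(?n * B)\<^sup>2"])
      show "AE x in M. norm ((X x)\<^sup>2) \<le> (?n * B)\<^sup>2"
        using Xb B by (intro AE_I2) (simp add: abs_le_square_iff[symmetric])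
    qed auto
    show "AE x in M. (q x * X x)\<^sup>2 \<le> (X x)\<^sup>2"
    proof (rule AE_I2)
      fix x assume "x \<in> space M"
      then have "(q x)\<^sup>2 \<le> 1" using q(2) by (simp add: abs_square_le_1)
      then have "(q x)\<^sup>2 * (X x)\<^sup>2 \<le> 1 * (X x)\<^sup>2" by (intro mult_right_mono) auto
      then show "(q x * X x)\<^sup>2 \<le> (X x)\<^sup>2" by (simp add: power_mult_distrib)
    qed
  qed auto
  also have "\<dots> = expectation (\<lambda>x. \<Sum>v\<in>S. \<Sum>w\<in>S. \<sigma> v * \<sigma> w * (g v x * g w x))"
    unfolding X_def power2_eq_square sum_product by (simp only: mult_ac)
  also have "\<dots> = (\<Sum>v\<in>S. \<Sum>w\<in>S. \<sigma> v * \<sigma> w * expectation (\<lambda>x. g v x * g w x))"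
    by (intro integral_double_sum intg)
  \<comment> \<open>The diagonal contributes at most n B^2; granting \<open>\<tau>\<close> to every
    pair, the diagonal included, adds n^2 \<open>\<tau>\<close>.\<close>
  also have "\<dots> \<le> (\<Sum>v\<in>S. \<Sum>w\<in>S. (if v = w then B\<^sup>2 else 0) + \<tau>)"
  proof (intro sum_mono)
    fix v w assume vw: "v \<in> S" "w \<in> S"
    have "\<bar>\<sigma> v * \<sigma> w\<bar> \<le> 1" using mult_mono[OF \<sigma>[of v] \<sigma>[of w]] by (simp add: abs_mult)
    then have "\<bar>\<sigma> v * \<sigma> w * expectation (\<lambda>x. g v x * g w x)\<bar> \<le> 1 * \<bar>expectation (\<lambda>x. g v x * g w x)\<bar>"
      unfolding abs_mult[of "\<sigma> v * \<sigma> w"] by (intro mult_right_mono) auto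
    moreover have "\<bar>expectation (\<lambda>x. g v x * g w x)\<bar> \<le> (if v = w then B\<^sup>2 else 0) + \<tau>"
    proof (cases "v = w")
      case True
      have "expectation (\<lambda>x. g w x * g w x) \<le> expectation (\<lambda>x. B\<^sup>2)"
      proof (rule integral_mono[OF intg])
        show "g w x * g w x \<le> B\<^sup>2" for x
          using g(2)[OF vw(2), of x] B by (simp add: abs_le_square_iff[symmetric] flip: power2_eq_square)
      qed (use vw in auto)
      moreover have "expectation (\<lambda>x. g w x * g w x) \<ge> 0" by (simp add: integral_nonneg)
      ultimately show ?thesis using True \<phi>(2) prob_space by simp
    qed (use orth vw in auto)
    ultimately show "\<sigma> v * \<sigma> w * expectation (\<lambda>x. g v x * g w x) \<le> (if v = w then B\<^sup>2 else 0) + \<tau>"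
      by linarith
  qed
  also have "\<dots> = ?n * (B\<^sup>2 + ?n * \<tau>)"
    using S by (simp add: sum.distrib sum.delta algebra_simps)
  finally have "?n * (?n * (\<phi>\<^sup>2 - \<tau>)) \<le> ?n * B\<^sup>2"
    by (simp add: power2_eq_square algebra_simps)
  then show ?thesis using n by (simp only: mult_le_cancel_left_pos)
qed simp

subsection \<open>Runs of a learner\<close>

text \<open>The normals are nearly opposite for small \<open>\<gamma>\<close>. Changing the sign of
  \<open>\<gamma>\<close> gives the opposite wedge, and off \<open>x 0 = 0\<close> the two concepts
  differ exactly on the double wedge.\<close>

definition wedge_concept :: "nat \<Rightarrow> real \<Rightarrow> point \<Rightarrow> point \<Rightarrow> int" where
  "wedge_concept d \<gamma> w = halfspace_intersection d (\<lambda>i. \<gamma> * first_axis i - w i) (\<lambda>i. \<gamma> * first_axis i + w i)"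

lemma wedge_concept_eq:
  assumes "0 < d"
  shows "wedge_concept d \<gamma> w x = (if \<bar>dot d w x\<bar> \<le> \<gamma> * x 0 then 1 else - 1)"
proof -
  have "dot d (\<lambda>i. \<gamma> * first_axis i - w i) x = \<gamma> * x 0 - dot d w x"
    using dot_linear_comb[of d \<gamma> first_axis "- 1" w x] dot_first_axis[OF assms] by simp
  moreover have "dot d (\<lambda>i. \<gamma> * first_axis i + w i) x = \<gamma> * x 0 + dot d w x"
    using dot_linear_comb[of d \<gamma> first_axis 1 w x] dot_first_axis[OF assms] by simp
  ultimately show ?thesis
    by (auto simp: wedge_concept_def halfspace_intersection_def abs_le_iff)
qed

lemma wedge_concept_in_class:
  assumes "0 < d" "\<gamma> \<noteq> 0" "w 0 = 0"
  shows "wedge_concept d \<gamma> w \<in> halfspace_intersections2 d"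
proof -
  have "nonzero_vector d (\<lambda>i. \<gamma> * first_axis i - w i)" "nonzero_vector d (\<lambda>i. \<gamma> * first_axis i + w i)"
    using assms by (auto simp: nonzero_vector_def first_axis_def intro!: exI[of _ 0])
  then show ?thesis unfolding wedge_concept_def halfspace_intersections2_def by blast
qed

section \<open>Runs as functions of the responses\<close>

lemma history_eq:
  assumes "\<And>t. t < n \<Longrightarrow> respond E' t (action_at A E t) = respond E t (action_at A E t)" and "t \<le> n"
  shows "history A E' t = history A E t"
  using assms(2)
proof (induction t)
  case (Suc t)
  then show ?case using assms(1)[of t] by (simp add: Let_def action_at_def)
qed simp

lemma halting_action_stable:
  assumes "halting (action_at A E t)" and "t \<le> u"
  shows "action_at A E u = action_at A E t"
proof -
  have "history A E u = history A E t"
    using assms(2,1) by (induction rule: dec_induct) (auto simp: action_at_def Let_def)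
  then show ?thesis by (simp add: action_at_def)
qed

lemma accepts_with_iff_halting_action:
  assumes "halting (action_at A E t)"
  shows "accepts_with A E h \<longleftrightarrow> action_at A E t = Accept h"
proof
  assume "accepts_with A E h"
  then obtain u where u: "action_at A E u = Accept h" by (auto simp: accepts_with_def)
  then have u': "halting (action_at A E u)" by simp
  show "action_at A E t = Accept h"
  proof (cases "u \<le> t")
    case True
    then show ?thesis using halting_action_stable[OF u' True] u by simp
  next
    case False
    then show ?thesis using halting_action_stable[OF assms, of u] u by simp
  qed
qed (auto simp: accepts_with_def)

text \<open>Agreement is demanded only on samples and queries occurring in the run in
  \<open>E\<close>; the run in \<open>E'\<close> then follows it by induction. This allows one run
  to be compared with many others whose queries are not known beforehand.\<close>

lemma same_responses_same_verdict:
  assumes "samples E' = samples E" "coins E' = coins E"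
    and "\<And>t. t < n \<Longrightarrow> concept E' (samples E t) = concept E (samples E t)"
    and "\<And>t q \<phi>. t < n \<Longrightarrow> action_at A E t = Query q \<phi> \<Longrightarrow> sq_answers E' q \<phi> = sq_answers E q \<phi>"
    and "t < n" "halting (action_at A E t)"
  shows "accepts_with A E' h \<longleftrightarrow> accepts_with A E h"
proof -
  have "respond E' u (action_at A E u) = respond E u (action_at A E u)" if "u < n" for u
    using assms(1-4) that by (cases "action_at A E u") auto
  then have "history A E' t = history A E t"
    by (rule history_eq) (use assms in auto)
  then have "action_at A E' t = action_at A E t" by (simp add: action_at_def)
  then show ?thesis using assms(6) accepts_with_iff_halting_action by metis
qed

section \<open>Samples, coins and exceptional events\<close>

lemma prob_space_randomness: "prob_space (randomness d)"
proof -
  interpret G: prob_space "\<Pi>\<^sub>M t\<in>(UNIV :: nat set). gaussian d"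
    by (intro prob_space_PiM prob_space_gaussian)
  interpret B: prob_space "\<Pi>\<^sub>M t\<in>(UNIV :: nat set). measure_pmf (bernoulli_pmf (1 / 2))"
    by (intro prob_space_PiM measure_pmf.prob_space_axioms)
  interpret P: pair_prob_space "\<Pi>\<^sub>M t\<in>(UNIV :: nat set). gaussian d"
      "\<Pi>\<^sub>M t\<in>(UNIV :: nat set). measure_pmf (bernoulli_pmf (1 / 2))" ..
  show ?thesis unfolding randomness_def by (rule P.prob_space_axioms)
qed

lemma sample_measurable [measurable]: "(\<lambda>\<omega>. fst \<omega> t) \<in> measurable (randomness d) (gaussian d)"
  unfolding randomness_def by measurable

lemma sample_in_space: "\<omega> \<in> space (randomness d) \<Longrightarrow> fst \<omega> t \<in> space (euclid d)"
  using measurable_space[OF sample_measurable] by (simp add: space_gaussian)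

lemma distr_sample: "distr (randomness d) (gaussian d) (\<lambda>\<omega>. fst \<omega> t) = gaussian d"
proof -
  let ?G = "\<Pi>\<^sub>M t\<in>(UNIV :: nat set). gaussian d"
  let ?B = "\<Pi>\<^sub>M t\<in>(UNIV :: nat set). measure_pmf (bernoulli_pmf (1 / 2))"
  interpret B: prob_space ?B
    by (intro prob_space_PiM measure_pmf.prob_space_axioms)
  have "distr (randomness d) (gaussian d) (\<lambda>\<omega>. fst \<omega> t) = distr (distr (?G \<Otimes>\<^sub>M ?B) ?G fst) (gaussian d) (\<lambda>x. x t)"
    unfolding randomness_def by (subst distr_distr) (auto simp: o_def)
  also have "distr (?G \<Otimes>\<^sub>M ?B) ?G fst = ?G"
    by (rule B.distr_pair_fst)
  also have "distr ?G (gaussian d) (\<lambda>x. x t) = gaussian d"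
    by (rule distr_PiM_component) (auto intro: prob_space_gaussian)
  finally show ?thesis .
qed

text \<open>By averaging: the expected number of events that occur is at least
  \<open>p * card W\<close>. It serves to fix samples and coins for many directions at once.\<close>

lemma (in prob_space) exists_point_in_many_events:
  assumes W: "finite W" "W \<noteq> {}" and H: "\<And>w. w \<in> W \<Longrightarrow> H w \<in> events" "\<And>w. w \<in> W \<Longrightarrow> p \<le> prob (H w)"
  shows "\<exists>\<omega>\<in>space M. p * card W \<le> card {w \<in> W. \<omega> \<in> H w}"
proof (rule ccontr)
  assume "\<not> ?thesis"
  then have less: "real (card {w \<in> W. \<omega> \<in> H w}) < p * card W" if "\<omega> \<in> space M" for \<omega>
    using that by (auto simp: not_le)
  let ?X = "\<lambda>\<omega>. \<Sum>w\<in>W. indicator (H w) \<omega> :: real"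
  have X: "?X \<omega> = card {w \<in> W. \<omega> \<in> H w}" for \<omega>
    using W by (simp add: indicator_def sum.If_cases Int_def)
  have int: "integrable M (indicator (H w) :: _ \<Rightarrow> real)" if "w \<in> W" for w
    using H(1)[OF that] by (intro integrable_real_indicator) (auto simp: less_top[symmetric])
  have "expectation ?X < p * card W"
  proof (rule expectation_less)
    show "integrable M ?X" by (intro Bochner_Integration.integrable_sum int)
    show "AE \<omega> in M. ?X \<omega> < p * card W" unfolding X by (intro AE_I2 less)
  qed
  moreover have "expectation ?X = (\<Sum>w\<in>W. prob (H w))"
    using H(1) int by (subst Bochner_Integration.integral_sum) auto
  moreover have "p * card W \<le> (\<Sum>w\<in>W. prob (H w))"
    using sum_mono[of W "\<lambda>_. p", OF H(2)] by (simp add: mult.commute)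
  ultimately show False by simp
qed

text \<open>A union bound over all \<open>n\<close> steps, which also counts samples never
  requested. The absolute value of coordinate 0 covers the wedges of \<open>\<gamma>\<close> and
  \<open>- \<gamma>\<close> together.\<close>

lemma samples_avoid_wedge:
  fixes n :: nat
  assumes d: "0 < d" and g: "0 < \<gamma>" "\<gamma> \<le> 1" and w: "sqlen d w = 1"
  defines "B \<equiv> {\<omega> \<in> space (randomness d). \<exists>t<n. \<bar>dot d w (fst \<omega> t)\<bar> \<le> \<gamma> * \<bar>fst \<omega> t 0\<bar>}"
  shows "B \<in> sets (randomness d)" and "measure (randomness d) B \<le> real n * (5 * sqrt \<gamma>)"
proof -
  interpret R: prob_space "randomness d" by (rule prob_space_randomness)
  let ?F = "{x \<in> space (gaussian d). \<bar>dot d w x\<bar> \<le> \<gamma> * \<bar>x 0\<bar>}"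
  let ?B = "\<lambda>t. (\<lambda>\<omega>. fst \<omega> t) -` ?F \<inter> space (randomness d)"
  have [measurable]: "dot d w \<in> borel_measurable (gaussian d)" "(\<lambda>x. x 0) \<in> borel_measurable (gaussian d)"
    using d by (simp_all add: measurable_gaussian component_measurable)
  have F: "?F \<in> sets (gaussian d)" by measurable
  have Bt: "?B t \<in> sets (randomness d)" for t
    by (rule measurable_sets[OF sample_measurable F])
  have B: "B = (\<Union>t<n. ?B t)"
    using measurable_space[OF sample_measurable] by (auto simp: B_def)
  show "B \<in> sets (randomness d)" unfolding B using Bt by auto
  have "measure (randomness d) B \<le> (\<Sum>t<n. measure (randomness d) (?B t))"
    unfolding B by (rule R.finite_measure_subadditive_finite) (use Bt in auto)
  also have "\<dots> = (\<Sum>t<n. measure (gaussian d) ?F)"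
  proof (intro sum.cong refl)
    fix t
    have "measure (distr (randomness d) (gaussian d) (\<lambda>\<omega>. fst \<omega> t)) ?F = measure (randomness d) (?B t)"
      by (rule measure_distr[OF sample_measurable F])
    then show "measure (randomness d) (?B t) = measure (gaussian d) ?F"
      by (simp only: distr_sample)
  qed
  also have "\<dots> \<le> real n * (5 * sqrt \<gamma>)"
    using mult_left_mono[OF gaussian_wedge_small[OF d g w], of "real n"] by simp
  finally show "measure (randomness d) B \<le> real n * (5 * sqrt \<gamma>)" .
qed

lemma env_in_environments:
  assumes "c \<in> C" "test_distribution d D" "sq_oracle d D v" "\<omega> \<in> space (randomness d)"
  shows "env c v \<omega> \<in> environments d C"
  using assms sample_in_space by (auto simp: environments_def env_def)

text \<open>A valid oracle for \<open>D\<close> that reveals as little as possible: its answer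
  deviates from the Gaussian one only on a query whose tolerance is too small to hide the
  difference.\<close>

definition lazy_oracle :: "nat \<Rightarrow> point measure \<Rightarrow> (point \<Rightarrow> real) \<Rightarrow> real \<Rightarrow> real" where
  "lazy_oracle d D q \<phi> =
    (if sq_query d q \<phi> \<and> \<phi> < \<bar>integral\<^sup>L D q - integral\<^sup>L (gaussian d) q\<bar>
     then integral\<^sup>L D q else integral\<^sup>L (gaussian d) q)"

lemma sq_oracle_lazy: "sq_oracle d D (lazy_oracle d D)"
  by (auto simp: sq_oracle_def lazy_oracle_def sq_query_def)

lemma tds_learner_sound:
  assumes "tds_learner d C \<epsilon> \<delta> A" "c \<in> C" "test_distribution d D" "sq_oracle d D v"
  obtains G where "G \<in> sets (randomness d)" "1 - \<delta> \<le> measure (randomness d) G"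
    "\<And>\<omega> f. \<omega> \<in> G \<Longrightarrow> accepts_with A (env c v \<omega>) f \<Longrightarrow> f \<in> hypotheses d"
    "\<And>\<omega> f. \<omega> \<in> G \<Longrightarrow> accepts_with A (env c v \<omega>) f \<Longrightarrow> measure D {x \<in> space D. c x \<noteq> f x} \<le> \<epsilon>"
proof -
  have "with_probability (randomness d) (1 - \<delta>)
      (\<lambda>\<omega>. \<forall>f. accepts_with A (env c v \<omega>) f \<longrightarrow>
        f \<in> hypotheses d \<and> measure D {x \<in> space D. c x \<noteq> f x} \<le> \<epsilon>)"
    using assms(1)[unfolded tds_learner_def, rule_format, OF assms(2-4)] by (rule conjunct1)
  then obtain G where "G \<in> sets (randomness d)" "1 - \<delta> \<le> measure (randomness d) G"
      "\<forall>\<omega>\<in>G. \<forall>f. accepts_with A (env c v \<omega>) f \<longrightarrow>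
        f \<in> hypotheses d \<and> measure D {x \<in> space D. c x \<noteq> f x} \<le> \<epsilon>"
    unfolding with_probability_def by (elim bexE conjE)
  then show thesis by (intro that[of G]) simp_all
qed

lemma tds_learner_complete:
  assumes "tds_learner d C \<epsilon> \<delta> A" "c \<in> C" "sq_oracle d (gaussian d) v"
  obtains G where "G \<in> sets (randomness d)" "1 - \<delta> \<le> measure (randomness d) G"
    "\<And>\<omega>. \<omega> \<in> G \<Longrightarrow> \<exists>f. accepts_with A (env c v \<omega>) f"
proof -
  have "with_probability (randomness d) (1 - \<delta>) (\<lambda>\<omega>. \<exists>f. accepts_with A (env c v \<omega>) f)"
    using assms(1)[unfolded tds_learner_def, rule_format, OF assms(2) test_distribution_gaussian assms(3)]
    by (auto dest: conjunct2)
  then obtain G where "G \<in> sets (randomness d)" "1 - \<delta> \<le> measure (randomness d) G"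
      "\<forall>\<omega>\<in>G. \<exists>f. accepts_with A (env c v \<omega>) f"
    unfolding with_probability_def by (elim bexE conjE)
  then show thesis by (intro that[of G]) simp_all
qed

text \<open>Under \<open>tilted d k h w\<close> the concepts \<open>wedge_concept d \<gamma> w\<close> and \<open>wedge_concept d (- \<gamma>) w\<close>
  differ with probability above \<open>2 * \<epsilon>\<close>, while the training data rarely tell them apart: acceptance
  would make the output inaccurate for one of them.\<close>

lemma learner_distinguishes:
  assumes d: "0 < d" and g: "0 < \<gamma>" "\<gamma> \<le> 1" and h: "h = (\<gamma> / 8)\<^sup>2 / 16"
    and w: "sqlen d w = 1" "w 0 = 0"
    and \<epsilon>: "2 * \<epsilon> < 1 / (4 * extrapolation_const k)" and \<delta>: "\<delta> \<le> 1 / 20"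
    and A: "tds_learner d (halfspace_intersections2 d) \<epsilon> \<delta> A"
    and halts: "\<And>E. E \<in> environments d (halfspace_intersections2 d) \<Longrightarrow> \<exists>t<n. halting (action_at A E t)"
    and n: "real n * (5 * sqrt \<gamma>) \<le> 1 / 20"
  shows "\<exists>H\<in>sets (randomness d). 4 / 5 \<le> measure (randomness d) H \<and> (\<forall>\<omega>\<in>H.
      (\<forall>t<n. wedge_concept d \<gamma> w (fst \<omega> t) = - 1) \<and>
      (\<exists>f. accepts_with A (env (wedge_concept d \<gamma> w) (lazy_oracle d (gaussian d)) \<omega>) f) \<and>
      \<not> (\<exists>f. accepts_with A (env (wedge_concept d \<gamma> w) (lazy_oracle d (tilted d k h w)) \<omega>) f))"
proof -
  interpret R: prob_space "randomness d" by (rule prob_space_randomness)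
  let ?C = "halfspace_intersections2 d" and ?D = "tilted d k h w"
  let ?c = "\<lambda>s. wedge_concept d s w"
  let ?v = "lazy_oracle d ?D" and ?g = "lazy_oracle d (gaussian d)"
  have h01: "0 < h" "h \<le> 1"
    using g power_le_one[of "\<gamma> / 8" 2] by (auto simp: h)
  have c: "?c \<gamma> \<in> ?C" "?c (- \<gamma>) \<in> ?C"
    using wedge_concept_in_class[of d _ w] d g w by auto
  have D: "test_distribution d ?D" by (rule test_distribution_tilted[OF h01 w(1)])
  then interpret T: prob_space ?D by (simp add: test_distribution_def)
  obtain G1 where G1: "G1 \<in> sets (randomness d)" "1 - \<delta> \<le> measure (randomness d) G1"
    "\<And>\<omega> f. \<omega> \<in> G1 \<Longrightarrow> accepts_with A (env (?c \<gamma>) ?v \<omega>) f \<Longrightarrow> f \<in> hypotheses d"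
    "\<And>\<omega> f. \<omega> \<in> G1 \<Longrightarrow> accepts_with A (env (?c \<gamma>) ?v \<omega>) f \<Longrightarrow> measure ?D {x \<in> space ?D. ?c \<gamma> x \<noteq> f x} \<le> \<epsilon>"
    using tds_learner_sound[OF A c(1) D sq_oracle_lazy] by blast
  obtain G2 where G2: "G2 \<in> sets (randomness d)" "1 - \<delta> \<le> measure (randomness d) G2"
    "\<And>\<omega> f. \<omega> \<in> G2 \<Longrightarrow> accepts_with A (env (?c (- \<gamma>)) ?v \<omega>) f \<Longrightarrow> f \<in> hypotheses d"
    "\<And>\<omega> f. \<omega> \<in> G2 \<Longrightarrow> accepts_with A (env (?c (- \<gamma>)) ?v \<omega>) f \<Longrightarrow> measure ?D {x \<in> space ?D. ?c (- \<gamma>) x \<noteq> f x} \<le> \<epsilon>"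
    using tds_learner_sound[OF A c(2) D sq_oracle_lazy] by blast
  obtain G3 where G3: "G3 \<in> sets (randomness d)" "1 - \<delta> \<le> measure (randomness d) G3"
      "\<And>\<omega>. \<omega> \<in> G3 \<Longrightarrow> \<exists>f. accepts_with A (env (?c \<gamma>) ?g \<omega>) f"
    using tds_learner_complete[OF A c(1) sq_oracle_lazy] by blast
  define B where "B = {\<omega> \<in> space (randomness d). \<exists>t<n. \<bar>dot d w (fst \<omega> t)\<bar> \<le> \<gamma> * \<bar>fst \<omega> t 0\<bar>}"
  have B: "B \<in> sets (randomness d)" "measure (randomness d) B \<le> 1 / 20"
    unfolding B_def
    by (rule samples_avoid_wedge(1)[OF d g w(1)],
        rule order.trans[OF samples_avoid_wedge(2)[OF d g w(1)] n])
  \<comment> \<open>Three failures of the learner, of probability at most 1/20 each, and a sample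
    hitting the double wedge, again at most 1/20, leave 4/5.\<close>
  define H where "H = space (randomness d) - ((space (randomness d) - G1) \<union> (space (randomness d) - G2)
      \<union> (space (randomness d) - G3) \<union> B)"
  have Hs: "H \<in> sets (randomness d)" using G1(1) G2(1) G3(1) B(1) by (auto simp: H_def)
  have "measure (randomness d) ((space (randomness d) - G1) \<union> (space (randomness d) - G2)
      \<union> (space (randomness d) - G3) \<union> B) \<le> \<delta> + \<delta> + \<delta> + 1 / 20"
  proof (intro order.trans[OF measure_Un_le] add_mono B sets.Un sets.compl_sets G1(1) G2(1) G3(1))
    show "measure (randomness d) (space (randomness d) - G1) \<le> \<delta>"
      using G1(2) by (subst R.prob_compl[OF G1(1)]) simp
    show "measure (randomness d) (space (randomness d) - G2) \<le> \<delta>"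
      using G2(2) by (subst R.prob_compl[OF G2(1)]) simp
    show "measure (randomness d) (space (randomness d) - G3) \<le> \<delta>"
      using G3(2) by (subst R.prob_compl[OF G3(1)]) simp
  qed
  then have Hp: "4 / 5 \<le> measure (randomness d) H"
    unfolding H_def using \<delta> G1(1) G2(1) G3(1) B(1) by (subst R.prob_compl) auto
  have labels: "?c s (fst \<omega> t) = - 1" if "\<omega> \<in> H" "t < n" "\<bar>s\<bar> \<le> \<gamma>" for \<omega> t s
  proof -
    have "\<gamma> * \<bar>fst \<omega> t 0\<bar> < \<bar>dot d w (fst \<omega> t)\<bar>"
      using that by (auto simp: H_def B_def not_le)
    moreover have "s * fst \<omega> t 0 \<le> \<gamma> * \<bar>fst \<omega> t 0\<bar>"
    proof -
      have "s * fst \<omega> t 0 \<le> \<bar>s\<bar> * \<bar>fst \<omega> t 0\<bar>" by (simp add: abs_ge_self flip: abs_mult)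
      also have "\<dots> \<le> \<gamma> * \<bar>fst \<omega> t 0\<bar>" using that(3) by (intro mult_right_mono) auto
      finally show ?thesis .
    qed
    ultimately show ?thesis using d by (simp add: wedge_concept_eq)
  qed
  have noacc: False if \<omega>: "\<omega> \<in> H" and f: "accepts_with A (env (?c \<gamma>) ?v \<omega>) f" for \<omega> f
  proof -
    have sp: "\<omega> \<in> space (randomness d)" and in12: "\<omega> \<in> G1" "\<omega> \<in> G2" using \<omega> by (auto simp: H_def)
    obtain t where t: "t < n" "halting (action_at A (env (?c \<gamma>) ?v \<omega>) t)"
      using halts[OF env_in_environments[OF c(1) D sq_oracle_lazy sp]] by blast
    \<comment> \<open>The oracle depends only on the test distribution, and all samples seen are
      labelled -1 by both concepts, so the runs coincide and output the same
      \<open>f\<close>.\<close>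
    have "accepts_with A (env (?c (- \<gamma>)) ?v \<omega>) f \<longleftrightarrow> accepts_with A (env (?c \<gamma>) ?v \<omega>) f"
    proof (rule same_responses_same_verdict[OF _ _ _ _ t])
      fix u assume "u < n"
      then show "concept (env (?c (- \<gamma>)) ?v \<omega>) (samples (env (?c \<gamma>) ?v \<omega>) u) =
          concept (env (?c \<gamma>) ?v \<omega>) (samples (env (?c \<gamma>) ?v \<omega>) u)"
        using labels[OF \<omega>, of u \<gamma>] labels[OF \<omega>, of u "- \<gamma>"] g by (simp add: env_def)
    qed (simp_all add: env_def)
    with f G1(3,4) G2(4) in12 have le: "measure ?D {x \<in> space ?D. ?c \<gamma> x \<noteq> f x} \<le> \<epsilon>"
        "measure ?D {x \<in> space ?D. ?c (- \<gamma>) x \<noteq> f x} \<le> \<epsilon>" and fh: "f \<in> hypotheses d"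
      by simp_all
    have cm: "(\<lambda>x. real_of_int (?c s x)) \<in> borel_measurable (euclid d)" for s
    proof -
      have "(\<lambda>x. if \<bar>dot d w x\<bar> \<le> s * x 0 then 1 else - 1 :: real) \<in> borel_measurable (euclid d)"
        by (intro measurable_If borel_measurable_le borel_measurable_abs borel_measurable_times
            borel_measurable_const dot_measurable component_measurable d)
      then show ?thesis
        by (simp add: wedge_concept_eq[OF d] if_distrib[of real_of_int] cong: if_cong)
    qed
    have fm: "(\<lambda>x. real_of_int (f x)) \<in> borel_measurable (euclid d)"
      using fh unfolding hypotheses_def by (rule measurable_compose) simp
    have ne: "{x \<in> space ?D. ?c s x \<noteq> f x} \<in> sets ?D" for s
      using borel_measurable_neq[OF cm fm, of s] by (simp add: sets_tilted space_tilted)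
    have W: "{x \<in> space ?D. ?c \<gamma> x \<noteq> ?c (- \<gamma>) x} \<in> sets (euclid d)"
      using borel_measurable_neq[OF cm cm, of \<gamma> "- \<gamma>"] by (simp add: space_tilted)
    \<comment> \<open>Wherever the two concepts differ, \<open>f\<close> errs for one of them. Hence
      its two errors add up to at least the mass of the double wedge, which exceeds
      \<open>2 * \<epsilon>\<close>.\<close>
    have "1 / (4 * extrapolation_const k) \<le> measure ?D {x \<in> space ?D. ?c \<gamma> x \<noteq> ?c (- \<gamma>) x}"
    proof (rule tilted_wedge[OF d g h w W])
      fix x assume x: "x \<in> space (euclid d)" "x 0 \<noteq> 0" "\<bar>dot d w x\<bar> \<le> \<gamma> * \<bar>x 0\<bar>"
      then have "\<gamma> * \<bar>x 0\<bar> > 0" using g by simp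
      then show "x \<in> {x \<in> space ?D. ?c \<gamma> x \<noteq> ?c (- \<gamma>) x}"
        using x d by (cases "x 0 > 0") (auto simp: wedge_concept_eq space_tilted)
    qed
    also have "\<dots> \<le> measure ?D ({x \<in> space ?D. ?c \<gamma> x \<noteq> f x} \<union> {x \<in> space ?D. ?c (- \<gamma>) x \<noteq> f x})"
      using ne by (intro T.finite_measure_mono) auto
    also have "\<dots> \<le> measure ?D {x \<in> space ?D. ?c \<gamma> x \<noteq> f x} + measure ?D {x \<in> space ?D. ?c (- \<gamma>) x \<noteq> f x}"
      using ne by (intro measure_Un_le) auto
    finally show False using le \<epsilon> by simp
  qed
  show ?thesis
  proof (intro bexI[OF _ Hs] conjI Hp ballI)
    fix \<omega> assume \<omega>: "\<omega> \<in> H"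
    then show "\<exists>f. accepts_with A (env (?c \<gamma>) ?g \<omega>) f"
      using G3(3) by (auto simp: H_def)
    show "\<forall>t<n. ?c \<gamma> (fst \<omega> t) = - 1" using labels[OF \<omega>] g by auto
    show "\<not> (\<exists>f. accepts_with A (env (?c \<gamma>) ?v \<omega>) f)" using noacc[OF \<omega>] by blast
  qed
qed

text \<open>A single Gaussian run has to separate a 4/5 fraction of the family with at most
  \<open>n\<close> queries, and each query separates only as many directions as near orthogonality
  permits.\<close>

lemma sq_dimension_bound:
  assumes d: "0 < d" and g: "0 < \<gamma>" "\<gamma> \<le> 1" and h: "h = (\<gamma> / 8)\<^sup>2 / 16"
    and W: "finite W" "W \<noteq> {}" "\<And>w. w \<in> W \<Longrightarrow> sqlen d w = 1" "\<And>w. w \<in> W \<Longrightarrow> w 0 = 0"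
      "\<And>v w. v \<in> W \<Longrightarrow> w \<in> W \<Longrightarrow> v \<noteq> w \<Longrightarrow> \<bar>dot d v w\<bar> \<le> r" and r: "0 \<le> r" "r\<^sup>2 \<le> 1 / 2"
    and \<epsilon>: "2 * \<epsilon> < 1 / (4 * extrapolation_const k)" and \<delta>: "\<delta> \<le> 1 / 20"
    and A: "tds_learner d (halfspace_intersections2 d) \<epsilon> \<delta> A"
    and halts: "\<And>E. E \<in> environments d (halfspace_intersections2 d) \<Longrightarrow> \<exists>t<n. halting (action_at A E t)"
    and tol: "\<And>E q \<phi>. E \<in> environments d (halfspace_intersections2 d) \<Longrightarrow> makes_query A E q \<phi> \<Longrightarrow>
      sq_query d q \<phi> \<Longrightarrow> \<phi>\<^sub>0 \<le> \<phi>"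
    and n: "real n * (5 * sqrt \<gamma>) \<le> 1 / 20" and \<phi>: "0 \<le> \<phi>\<^sub>0" "2 * r ^ (2 * k + 2) \<le> \<phi>\<^sub>0\<^sup>2"
  shows "4 / 5 * real (card W) * (\<phi>\<^sub>0\<^sup>2 - 2 * r ^ (2 * k + 2)) \<le> real n * (2 / h)\<^sup>2"
proof -
  interpret R: prob_space "randomness d" by (rule prob_space_randomness)
  interpret G: prob_space "gaussian d" by (rule prob_space_gaussian)
  let ?C = "halfspace_intersections2 d" and ?g = "lazy_oracle d (gaussian d)"
  have h01: "0 < h" "h \<le> 1"
    using g power_le_one[of "\<gamma> / 8" 2] by (auto simp: h)
  let ?P = "\<lambda>w \<omega>. (\<forall>t<n. wedge_concept d \<gamma> w (fst \<omega> t) = - 1) \<and>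
      (\<exists>f. accepts_with A (env (wedge_concept d \<gamma> w) ?g \<omega>) f) \<and>
      \<not> (\<exists>f. accepts_with A (env (wedge_concept d \<gamma> w) (lazy_oracle d (tilted d k h w)) \<omega>) f)"
  have "\<forall>w\<in>W. \<exists>H. H \<in> sets (randomness d) \<and> 4 / 5 \<le> measure (randomness d) H \<and> (\<forall>\<omega>\<in>H. ?P w \<omega>)"
  proof
    fix w assume "w \<in> W"
    with learner_distinguishes[OF d g h W(3)[of w] W(4)[of w] \<epsilon> \<delta> A halts n]
    show "\<exists>H. H \<in> sets (randomness d) \<and> 4 / 5 \<le> measure (randomness d) H \<and> (\<forall>\<omega>\<in>H. ?P w \<omega>)"
      by blast
  qed
  then obtain H where H: "\<And>w. w \<in> W \<Longrightarrow> H w \<in> sets (randomness d)"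
      "\<And>w. w \<in> W \<Longrightarrow> 4 / 5 \<le> measure (randomness d) (H w)"
      "\<And>w \<omega>. w \<in> W \<Longrightarrow> \<omega> \<in> H w \<Longrightarrow> ?P w \<omega>"
    unfolding bchoice_iff by blast
  \<comment> \<open>From here on samples and coins are fixed, so that every run is
    deterministic.\<close>
  obtain \<omega> where \<omega>: "\<omega> \<in> space (randomness d)" "4 / 5 * card W \<le> card {w \<in> W. \<omega> \<in> H w}"
    using R.exists_point_in_many_events[where H = H and p = "4 / 5", OF W(1,2) H(1,2)] by blast
  define S where "S = {w \<in> W. \<omega> \<in> H w}"
  have S: "finite S" "S \<subseteq> W" using W by (auto simp: S_def)
  have P: "?P w \<omega>" if "w \<in> S" for w using that H(3) by (auto simp: S_def)
  have "real (card S) > 0"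
    using \<omega>(2) W(1,2) card_gt_0_iff[of W] by (fold S_def) linarith
  \<comment> \<open>Any member of \<open>S\<close> may define the reference run: for all of them the
    labels of the first \<open>n\<close> samples are -1.\<close>
  then obtain u where u: "u \<in> S" by (metis card.empty ex_in_conv less_irrefl of_nat_0)
  define E where "E = env (wedge_concept d \<gamma> u) ?g \<omega>"
  have E: "E \<in> environments d ?C"
    unfolding E_def using u S(2) W(4) d g
    by (intro env_in_environments[OF _ test_distribution_gaussian sq_oracle_lazy \<omega>(1)] wedge_concept_in_class) auto
  obtain t where t: "t < n" "halting (action_at A E t)" using halts[OF E] by blast
  define Z where "Z t = {w \<in> S. \<exists>q \<phi>. action_at A E t = Query q \<phi> \<and> sq_query d q \<phi> \<and>
      \<phi> < \<bar>integral\<^sup>L (tilted d k h w) q - integral\<^sup>L (gaussian d) q\<bar>}" for t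
  \<comment> \<open>If no query of the reference run separated \<open>w\<close>, the lazy oracle for
    \<open>w\<close> would repeat the Gaussian answers, and the run for \<open>w\<close> would
    accept although it must not.\<close>
  have "S \<subseteq> (\<Union>t<n. Z t)"
  proof
    fix w assume w: "w \<in> S"
    show "w \<in> (\<Union>t<n. Z t)"
    proof (rule ccontr)
      assume nZ: "w \<notin> (\<Union>t<n. Z t)"
      obtain f where "accepts_with A E f" using P[OF u] by (auto simp: E_def)
      then have "accepts_with A (env (wedge_concept d \<gamma> w) (lazy_oracle d (tilted d k h w)) \<omega>) f"
        using P[OF u] P[OF w] nZ w
        by (subst same_responses_same_verdict[where E = E, OF _ _ _ _ t])
           (auto simp: E_def env_def Z_def lazy_oracle_def)
      then show False using P[OF w] by blast
    qed
  qed
  then have "card S \<le> card (\<Union>t<n. Z t)"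
    by (rule card_mono[rotated]) (use S in \<open>auto simp: Z_def\<close>)
  also have "\<dots> \<le> (\<Sum>t<n. card (Z t))" by (rule card_UN_le) simp
  finally have cS: "real (card S) \<le> (\<Sum>t<n. real (card (Z t)))" by (simp flip: of_nat_sum)
  let ?\<tau> = "2 * r ^ (2 * k + 2)"
  have Z: "real (card (Z t)) * (\<phi>\<^sub>0\<^sup>2 - ?\<tau>) \<le> (2 / h)\<^sup>2" for t
  proof (cases "Z t = {}")
    case False
    then obtain q \<phi> where q: "action_at A E t = Query q \<phi>" "sq_query d q \<phi>" by (auto simp: Z_def)
    have \<phi>': "\<phi>\<^sub>0 \<le> \<phi>" using tol[OF E _ q(2)] q(1) by (auto simp: makes_query_def)
    have qm: "q \<in> borel_measurable (euclid d)" "\<And>x. x \<in> space (euclid d) \<Longrightarrow> \<bar>q x\<bar> \<le> 1"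
      using q(2) by (auto simp: sq_query_def abs_le_iff minus_le_iff)
    have ZW: "w \<in> W" if "w \<in> Z t" for w using that S by (auto simp: Z_def)
    show ?thesis
    proof (rule G.nearly_orthogonal_correlation_bound[where g = "\<lambda>w x. bump k h (dot d w x)" and q = q])
      show "finite (Z t)" using S by (auto simp: Z_def)
      show "\<bar>bump k h (dot d w x)\<bar> \<le> 2 / h" for w x by (rule bump_abs_le[OF h01])
      show "(\<lambda>x. bump k h (dot d w x)) \<in> borel_measurable (gaussian d)" for w
        by (simp add: measurable_gaussian)
      show "q \<in> borel_measurable (gaussian d)" "\<And>x. x \<in> space (gaussian d) \<Longrightarrow> \<bar>q x\<bar> \<le> 1"
        using qm by (auto simp: measurable_gaussian space_gaussian)
    next
      fix v w assume vw: "v \<in> Z t" "w \<in> Z t" "v \<noteq> w"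
      then have le: "\<bar>dot d v w\<bar> \<le> r" using W(5) ZW by blast
      then have "(dot d v w)\<^sup>2 \<le> r\<^sup>2" using r by (simp add: abs_le_square_iff[symmetric])
      then have "\<bar>G.expectation (\<lambda>x. bump k h (dot d v x) * bump k h (dot d w x))\<bar> \<le> 2 * dot d v w ^ (2 * k + 2)"
        using r vw ZW W(3) by (intro bump_correlation h01) auto
      also have "\<dots> \<le> ?\<tau>"
        using power_mono[OF le abs_ge_zero, of "2 * k + 2"] by (simp add: power_even_abs)
      finally show "\<bar>G.expectation (\<lambda>x. bump k h (dot d v x) * bump k h (dot d w x))\<bar> \<le> ?\<tau>" .
    next
      fix w assume w: "w \<in> Z t"
      have iq: "integrable (gaussian d) q"
        by (rule G.integrable_const_bound[where B = 1]) (use qm in \<open>auto simp: measurable_gaussian space_gaussian\<close>)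
      have ib: "integrable (gaussian d) (\<lambda>x. q x * bump k h (dot d w x))"
      proof (rule G.integrable_const_bound[where B = "1 * (2 / h)"])
        show "AE x in gaussian d. norm (q x * bump k h (dot d w x)) \<le> 1 * (2 / h)"
          unfolding real_norm_def abs_mult
          by (intro AE_I2 mult_mono bump_abs_le[OF h01]) (use qm in \<open>auto simp: space_gaussian\<close>)
      qed (use qm in \<open>auto simp: measurable_gaussian\<close>)
      have "integral\<^sup>L (tilted d k h w) q = (LINT x|gaussian d. (1 + bump k h (dot d w x)) * q x)"
        by (rule integral_tilted[OF h01 qm(1)])
      also have "\<dots> = integral\<^sup>L (gaussian d) q + (LINT x|gaussian d. q x * bump k h (dot d w x))"
        using iq ib by (simp add: algebra_simps)
      finally have "integral\<^sup>L (tilted d k h w) q - integral\<^sup>L (gaussian d) q = (LINT x|gaussian d. q x * bump k h (dot d w x))"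
        by simp
      moreover have "\<phi> < \<bar>integral\<^sup>L (tilted d k h w) q - integral\<^sup>L (gaussian d) q\<bar>"
        using w q by (auto simp: Z_def)
      ultimately show "\<phi>\<^sub>0 \<le> \<bar>(LINT x|gaussian d. q x * bump k h (dot d w x))\<bar>" using \<phi>' by simp
    qed (use \<phi> r in auto)
  qed simp
  have "4 / 5 * real (card W) * (\<phi>\<^sub>0\<^sup>2 - ?\<tau>) \<le> real (card S) * (\<phi>\<^sub>0\<^sup>2 - ?\<tau>)"
    using \<omega>(2) \<phi>(2) by (intro mult_right_mono) (auto simp: S_def)
  also have "\<dots> \<le> (\<Sum>t<n. real (card (Z t))) * (\<phi>\<^sub>0\<^sup>2 - ?\<tau>)"
    using cS \<phi>(2) by (intro mult_right_mono) auto
  also have "\<dots> \<le> (\<Sum>t<n. (2 / h)\<^sup>2)"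
    unfolding sum_distrib_right by (intro sum_mono Z)
  finally show ?thesis by simp
qed

subsection \<open>The lower bound\<close>

text \<open>Coordinate \<open>0\<close> is left free; it is the direction of the opening of the wedges.\<close>

definition code_support :: "nat \<Rightarrow> (nat \<Rightarrow> nat) \<Rightarrow> nat set" where
  "code_support m f = (\<lambda>a. Suc (a * m\<^sup>2 + f a)) ` {..<m}"

text \<open>A unit vector with one nonzero coordinate in each of \<open>m\<close> consecutive blocks
  of length \<open>m^2\<close>; inner products count the blocks in which the choices
  coincide.\<close>

definition code_vector :: "nat \<Rightarrow> (nat \<Rightarrow> nat) \<Rightarrow> point" where
  "code_vector m f i = of_bool (i \<in> code_support m f) / sqrt m"

lemma dot_code_vector:
  assumes f: "f \<in> {..<m} \<rightarrow>\<^sub>E {..<m\<^sup>2}" and g: "g \<in> {..<m} \<rightarrow>\<^sub>E {..<m\<^sup>2}" and d: "m ^ 3 < d"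
  shows "dot d (code_vector m f) (code_vector m g) = card {a \<in> {..<m}. f a = g a} / m"
proof -
  have fg: "f a < m\<^sup>2" "g a < m\<^sup>2" if "a < m" for a using f g that by (auto simp: PiE_iff)
  have inj: "a = b \<and> u = v" if "a * m\<^sup>2 + u = b * m\<^sup>2 + v" "u < m\<^sup>2" "v < m\<^sup>2" for a b u v
  proof -
    have div: "(c * M + w) div M = c" if "w < M" for c w M :: nat
      using that by (cases "M = 0") auto
    have "a = b" using div[OF that(2), of a] div[OF that(3), of b] that(1) by simp
    then show ?thesis using that(1) by simp
  qed
  have "i < d" if i: "i \<in> code_support m f" for i
  proof -
    from i obtain a where a: "a < m" "i = Suc (a * m\<^sup>2 + f a)" by (auto simp: code_support_def)
    have "a * m\<^sup>2 + f a < Suc a * m\<^sup>2" using fg(1)[OF a(1)] by simp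
    also have "\<dots> \<le> m * m\<^sup>2" using a(1) by (intro mult_right_mono) auto
    finally have "i \<le> m ^ 3" using a(2) by (simp add: power2_eq_square power3_eq_cube)
    with d show ?thesis by simp
  qed
  then have sub: "code_support m f \<inter> code_support m g \<subseteq> {..<d}" by auto
  have int: "code_support m f \<inter> code_support m g = (\<lambda>a. Suc (a * m\<^sup>2 + f a)) ` {a \<in> {..<m}. f a = g a}"
  proof (intro equalityI subsetI)
    fix i assume "i \<in> code_support m f \<inter> code_support m g"
    then obtain a b where ab: "a < m" "b < m" "i = Suc (a * m\<^sup>2 + f a)" "a * m\<^sup>2 + f a = b * m\<^sup>2 + g b"
      by (auto simp: code_support_def)
    then have "a = b \<and> f a = g b" by (intro inj fg) auto
    then show "i \<in> (\<lambda>a. Suc (a * m\<^sup>2 + f a)) ` {a \<in> {..<m}. f a = g a}" using ab by auto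
  next
    fix i assume "i \<in> (\<lambda>a. Suc (a * m\<^sup>2 + f a)) ` {a \<in> {..<m}. f a = g a}"
    then obtain a where "a < m" "f a = g a" "i = Suc (a * m\<^sup>2 + f a)" by auto
    then show "i \<in> code_support m f \<inter> code_support m g"
      unfolding code_support_def by (intro IntI image_eqI[of _ _ a]) auto
  qed
  have "inj_on (\<lambda>a. Suc (a * m\<^sup>2 + f a)) {a \<in> {..<m}. f a = g a}"
  proof (rule inj_onI)
    fix a b assume "a \<in> {a \<in> {..<m}. f a = g a}" "b \<in> {a \<in> {..<m}. f a = g a}"
      and "Suc (a * m\<^sup>2 + f a) = Suc (b * m\<^sup>2 + f b)"
    then show "a = b" using inj[of a "f a" b "f b"] fg(1)[of a] fg(1)[of b] by simp
  qed
  then have card: "card (code_support m f \<inter> code_support m g) = card {a \<in> {..<m}. f a = g a}"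
    unfolding int by (rule card_image)
  let ?S = "code_support m f \<inter> code_support m g"
  have "code_vector m f i * code_vector m g i = (if i \<in> ?S then 1 / m else 0)" for i
    by (simp add: code_vector_def)
  then have "dot d (code_vector m f) (code_vector m g) = (\<Sum>i\<in>{..<d}. if i \<in> ?S then 1 / m else 0)"
    unfolding dot_def by (simp only:)
  also have "\<dots> = (\<Sum>i\<in>{..<d} \<inter> ?S. 1 / m)"
    by (rule sum.inter_restrict[symmetric]) simp
  also have "{..<d} \<inter> ?S = ?S" using sub by blast
  finally show ?thesis by (simp add: card)
qed

lemma exists_nearly_orthogonal_family:
  assumes R: "0 < R" "R \<le> m" and d: "m ^ 3 < d"
  obtains W where "finite W" "m ^ R \<le> card W" "\<And>w. w \<in> W \<Longrightarrow> sqlen d w = 1" "\<And>w. w \<in> W \<Longrightarrow> w 0 = 0"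
    "\<And>v w. v \<in> W \<Longrightarrow> w \<in> W \<Longrightarrow> v \<noteq> w \<Longrightarrow> \<bar>dot d v w\<bar> \<le> R / m"
proof -
  obtain C where C: "C \<subseteq> {..<m} \<rightarrow>\<^sub>E {..<m\<^sup>2}" "m ^ R \<le> card C"
    "\<And>f g. f \<in> C \<Longrightarrow> g \<in> C \<Longrightarrow> f \<noteq> g \<Longrightarrow> card {a \<in> {..<m}. f a = g a} < R"
    using exists_code[OF R] by blast
  have fin: "finite C" using C(1) by (rule finite_subset) (intro finite_PiE, auto)
  have dot: "dot d (code_vector m f) (code_vector m g) = card {a \<in> {..<m}. f a = g a} / m"
    if "f \<in> C" "g \<in> C" for f g using that C(1) d by (intro dot_code_vector) auto
  have self: "dot d (code_vector m f) (code_vector m f) = 1" if "f \<in> C" for f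
    using dot[OF that that] R by simp
  have "inj_on (code_vector m) C"
  proof (rule inj_onI, rule ccontr)
    fix f g assume fg: "f \<in> C" "g \<in> C" "code_vector m f = code_vector m g" "f \<noteq> g"
    have "real (card {a \<in> {..<m}. f a = g a}) / m = 1"
      using dot[OF fg(1,2)] self[OF fg(2)] fg(3) by simp
    then have "card {a \<in> {..<m}. f a = g a} = m" using R by simp
    then show False using C(3)[OF fg(1,2,4)] R by simp
  qed
  then have "card (code_vector m ` C) = card C" by (rule card_image)
  show ?thesis
  proof (rule that[of "code_vector m ` C"])
    show "finite (code_vector m ` C)" using fin by simp
    show "m ^ R \<le> card (code_vector m ` C)" using C(2) \<open>card (code_vector m ` C) = card C\<close> by simp
    show "sqlen d w = 1" if "w \<in> code_vector m ` C" for w using that self by auto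
    show "w 0 = 0" if "w \<in> code_vector m ` C" for w
      using that by (auto simp: code_vector_def code_support_def)
    show "\<bar>dot d v w\<bar> \<le> R / m" if vw: "v \<in> code_vector m ` C" "w \<in> code_vector m ` C" "v \<noteq> w" for v w
    proof -
      obtain f g where fg: "f \<in> C" "g \<in> C" "v = code_vector m f" "w = code_vector m g" "f \<noteq> g"
        using vw by auto
      then have "real (card {a \<in> {..<m}. f a = g a}) \<le> R" using C(3)[OF fg(1,2,5)] by simp
      then show ?thesis using fg dot[OF fg(1,2)] by (simp add: divide_right_mono)
    qed
  qed
qed

section \<open>Choice of the parameters\<close>

definition spike_const :: real where
  "spike_const = 2048 * 200 ^ 4"

text \<open>Exponents of y with s = k + 1: the family has size at least 12 s + 8, the squared
  tolerance is -2 s, the number of steps s, and the squared bound on the bump 8 s. The dimension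
  bound would thus place 10 s + 8 below 9 s up to constants. The vectors fit because
  \<open>m\<close> is about y^2 and m^3, about y^6, is less than d = y^8.\<close>

lemma no_fast_learner:
  fixes y :: real and k :: nat
  defines "R \<equiv> 6 * Suc k + 4" and "n \<equiv> nat \<lceil>y ^ Suc k\<rceil>"
  assumes y: "1 \<le> y" "real d = y ^ 8" "(y\<^sup>2 + 1) ^ 3 < y ^ 8" "2 * real R \<le> y\<^sup>2"
      "4 * real R ^ (2 * Suc k) \<le> y\<^sup>2" "5 * spike_const\<^sup>2 < y ^ 8"
    and \<epsilon>: "2 * \<epsilon> < 1 / (4 * extrapolation_const k)" and \<delta>: "\<delta> \<le> 1 / 20"
    and A: "tds_learner d (halfspace_intersections2 d) \<epsilon> \<delta> A"
    and halts: "\<And>E. E \<in> environments d (halfspace_intersections2 d) \<Longrightarrow> \<exists>t<n. halting (action_at A E t)"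
    and tol: "\<And>E q \<phi>. E \<in> environments d (halfspace_intersections2 d) \<Longrightarrow> makes_query A E q \<phi> \<Longrightarrow>
      sq_query d q \<phi> \<Longrightarrow> 1 / y ^ Suc k \<le> \<phi>"
  shows False
proof -
  define s where "s = Suc k"
  define m where "m = nat \<lfloor>y\<^sup>2\<rfloor> + 1"
  \<comment> \<open>Since \<open>n\<close> is at most 2 y^s, the constant 200 gives exactly the 1/20
    allowed for a sample in the wedge.\<close>
  define \<gamma> where "\<gamma> = (1 / (200 * y ^ s))\<^sup>2"
  define h where "h = (\<gamma> / 8)\<^sup>2 / 16"
  have s: "s \<ge> 1" by (simp add: s_def)
  have m: "y\<^sup>2 \<le> real m" "real m \<le> y\<^sup>2 + 1" using y(1) by (auto simp: m_def) linarith+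
  have "real (m ^ 3) \<le> (y\<^sup>2 + 1) ^ 3" using m(2) by (simp add: power_mono)
  then have md: "m ^ 3 < d" using y(2,3) by (metis of_nat_less_iff order.strict_trans1)
  then have d: "0 < d" by simp
  have y2: "1 \<le> y\<^sup>2" using y(1) by (simp add: one_le_power)
  have R: "0 < R" "R \<le> m" "2 * real R \<le> real m" using y(4) m(1) by (auto simp: R_def)
  have ys: "y ^ s \<ge> 1" using y(1) by (simp add: one_le_power)
  have \<gamma>: "0 < \<gamma>" "\<gamma> \<le> 1" "sqrt \<gamma> = 1 / (200 * y ^ s)"
  proof -
    have "1 \<le> 200 * y ^ s" using ys by linarith
    then show "0 < \<gamma>" "\<gamma> \<le> 1" "sqrt \<gamma> = 1 / (200 * y ^ s)"
      using y(1) by (auto simp: \<gamma>_def intro!: power_le_one)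
  qed
  have n: "real n \<le> 2 * y ^ s"
  proof -
    have "0 \<le> \<lceil>y ^ s\<rceil>" using ys by linarith
    then have "real n = of_int \<lceil>y ^ s\<rceil>" by (simp only: n_def s_def[symmetric] of_nat_nat)
    then show ?thesis using of_int_ceiling_le_add_one[of "y ^ s"] ys by linarith
  qed
  obtain W where W: "finite W" "m ^ R \<le> card W" "\<And>w. w \<in> W \<Longrightarrow> sqlen d w = 1" "\<And>w. w \<in> W \<Longrightarrow> w 0 = 0"
    "\<And>v w. v \<in> W \<Longrightarrow> w \<in> W \<Longrightarrow> v \<noteq> w \<Longrightarrow> \<bar>dot d v w\<bar> \<le> R / m"
    using exists_nearly_orthogonal_family[OF R(1,2) md] by blast
  have "m ^ R > 0" using R by simp
  then have ne: "W \<noteq> {}" using W(2) by auto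
  define r where "r = real R / m"
  have r: "0 \<le> r" "r \<le> 1 / 2" "r \<le> R / y\<^sup>2"
  proof -
    show "0 \<le> r" by (simp add: r_def)
    show "r \<le> 1 / 2" using R by (simp add: r_def field_simps)
    show "r \<le> R / y\<^sup>2" unfolding r_def using m(1) y2 by (intro frac_le) auto
  qed
  have "r\<^sup>2 \<le> (1 / 2)\<^sup>2" using r by (intro power_mono) auto
  then have r2: "r\<^sup>2 \<le> 1 / 2" by (simp add: power2_eq_square)
  \<comment> \<open>With r \<le> R / y^2 the correlation is of order y^(-4 s), while half the
    squared tolerance is of order y^(-2 s). The gap of y^(2 s) is at least y^2, which absorbs the
    constant 4 R^(2 s).\<close>
  have small: "2 * r ^ (2 * k + 2) \<le> (1 / y ^ s)\<^sup>2 / 2"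
  proof -
    have "2 * r ^ (2 * k + 2) = 2 * r ^ (2 * s)" by (simp add: s_def)
    also have "\<dots> \<le> 2 * (R / y\<^sup>2) ^ (2 * s)" using r by (intro mult_left_mono power_mono) auto
    also have "\<dots> = (4 * real R ^ (2 * s)) / (2 * y ^ (4 * s))"
      by (simp add: power_divide flip: power_mult)
    also have "\<dots> \<le> y\<^sup>2 / (2 * y ^ (4 * s))"
      using y(1,5) by (intro divide_right_mono) (auto simp: s_def)
    also have "\<dots> \<le> y ^ (2 * s) / (2 * y ^ (4 * s))"
      using y(1) s by (intro divide_right_mono power_increasing) auto
    also have "\<dots> = (1 / y ^ s)\<^sup>2 / 2"
    proof -
      have "y ^ (4 * s) = y ^ (2 * s) * y ^ (2 * s)" by (simp flip: power_add)
      moreover have "(y ^ s)\<^sup>2 = y ^ (2 * s)" by (simp add: mult.commute flip: power_mult)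
      ultimately show ?thesis using y(1) by (simp add: power_divide)
    qed
    finally show ?thesis .
  qed
  have b1: "4 / 5 * real (card W) * ((1 / y ^ s)\<^sup>2 - 2 * r ^ (2 * k + 2)) \<le> real n * (2 / h)\<^sup>2"
  proof (rule sq_dimension_bound[OF d \<gamma>(1,2) h_def W(1) ne _ _ _ r(1) r2 \<epsilon> \<delta> A])
    show "sqlen d w = 1" "w 0 = 0" if "w \<in> W" for w using W(3,4)[OF that] by simp_all
    show "\<exists>t<n. halting (action_at A E t)" if "E \<in> environments d (halfspace_intersections2 d)" for E
      using halts[OF that] .
    show "\<bar>dot d v w\<bar> \<le> r" if "v \<in> W" "w \<in> W" "v \<noteq> w" for v w using W(5)[OF that] by (simp add: r_def)
    show "1 / y ^ s \<le> \<phi>" if "E \<in> environments d (halfspace_intersections2 d)" "makes_query A E q \<phi>" "sq_query d q \<phi>" for E q \<phi>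
      using tol[OF that] by (simp add: s_def)
    have "real n * (5 * sqrt \<gamma>) \<le> 2 * y ^ s * (5 * sqrt \<gamma>)" using n \<gamma>(1) by (intro mult_right_mono) auto
    also have "\<dots> = 1 / 20" using ys y(1) by (simp add: \<gamma>(3))
    finally show "real n * (5 * sqrt \<gamma>) \<le> 1 / 20" .
    show "2 * r ^ (2 * k + 2) \<le> (1 / y ^ s)\<^sup>2" using small zero_le_power2[of "1 / y ^ s"] by linarith
  qed (use ys in auto)
  \<comment> \<open>Here h is \<open>\<gamma>\<close>^2 / 1024, so 2 / h is 2048 /
    \<open>\<gamma>\<close>^2; this is the origin of \<open>spike_const\<close>.\<close>
  have b2: "(2 / h)\<^sup>2 = spike_const\<^sup>2 * y ^ (8 * s)"
  proof -
    have "2 / h = 2048 / \<gamma>\<^sup>2" by (simp add: h_def power_divide)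
    also have "\<dots> = 2048 * (200 * y ^ s) ^ 4"
    proof -
      have "2048 / ((1 / z)\<^sup>2)\<^sup>2 = 2048 * z ^ 4" for z :: real
        by (simp add: power_divide flip: power_mult)
      then show ?thesis unfolding \<gamma>_def .
    qed
    also have "\<dots> = spike_const * y ^ (4 * s)"
    proof -
      have "(y ^ s) ^ 4 = y ^ (4 * s)" by (simp only: mult.commute[of 4 s] power_mult)
      then show ?thesis by (simp add: spike_const_def power_mult_distrib)
    qed
    finally have "(2 / h)\<^sup>2 = spike_const\<^sup>2 * (y ^ (4 * s))\<^sup>2" by (simp only: power_mult_distrib)
    moreover have "4 * s * 2 = 8 * s" by simp
    ultimately show ?thesis by (simp only: power_mult[symmetric])
  qed
  have b3: "real n * (spike_const\<^sup>2 * y ^ (8 * s)) \<le> 2 * y ^ s * (spike_const\<^sup>2 * y ^ (8 * s))"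
    using n y(1) by (intro mult_right_mono) auto
  have b4: "4 / 5 * y ^ (12 * s + 8) * ((1 / y ^ s)\<^sup>2 / 2) \<le> 4 / 5 * real (card W) * ((1 / y ^ s)\<^sup>2 - 2 * r ^ (2 * k + 2))"
  proof (intro mult_mono)
    have "y ^ (12 * s + 8) = (y\<^sup>2) ^ R" by (simp add: R_def s_def flip: power_mult)
    also have "\<dots> \<le> real m ^ R" using m(1) y2 by (intro power_mono) auto
    also have "\<dots> \<le> real (card W)" using W(2) by (simp flip: of_nat_power)
    finally show "y ^ (12 * s + 8) \<le> real (card W)" .
    show "(1 / y ^ s)\<^sup>2 / 2 \<le> (1 / y ^ s)\<^sup>2 - 2 * r ^ (2 * k + 2)" using small by linarith
  qed (use y(1) in auto)
  have le: "4 / 5 * y ^ (12 * s + 8) * ((1 / y ^ s)\<^sup>2 / 2) \<le> 2 * y ^ s * (spike_const\<^sup>2 * y ^ (8 * s))"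
    by (rule order.trans[OF b4 order.trans[OF b1[unfolded b2] b3]])
  have e1: "y ^ (12 * s + 8) * (1 / y ^ s)\<^sup>2 = y ^ (9 * s) * y ^ (s + 8)"
  proof -
    have "12 * s + 8 = 9 * s + (s + 8) + s * 2" by simp
    then have "y ^ (12 * s + 8) = y ^ (9 * s) * y ^ (s + 8) * (y ^ s)\<^sup>2"
      by (simp only: power_add power_mult)
    moreover have "a * z\<^sup>2 * (1 / z)\<^sup>2 = a" if "z \<ge> 1" for a z :: real
      using that by (simp add: power_divide)
    ultimately show ?thesis using ys by (simp only:)
  qed
  have e2: "y ^ s * y ^ (8 * s) = y ^ (9 * s)"
  proof -
    have "9 * s = s + 8 * s" by simp
    then show ?thesis by (simp only: power_add)
  qed
  have "y ^ (9 * s) * (2 / 5 * y ^ (s + 8)) = 2 / 5 * (y ^ (12 * s + 8) * (1 / y ^ s)\<^sup>2)"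
    unfolding e1 by (simp only: mult_ac)
  also have "\<dots> = 4 / 5 * y ^ (12 * s + 8) * ((1 / y ^ s)\<^sup>2 / 2)" by (simp del: power_divide)
  also note le
  also have "2 * y ^ s * (spike_const\<^sup>2 * y ^ (8 * s)) = 2 * spike_const\<^sup>2 * (y ^ s * y ^ (8 * s))"
    by (simp only: mult_ac)
  also have "\<dots> = y ^ (9 * s) * (2 * spike_const\<^sup>2)" unfolding e2 by (simp only: mult_ac)
  finally have "2 / 5 * y ^ (s + 8) \<le> 2 * spike_const\<^sup>2"
    by (rule mult_left_le_imp_le) (use y(1) in simp)
  moreover have "y ^ 8 \<le> y ^ (s + 8)" using y(1) by (intro power_increasing) auto
  ultimately show False using y(6) by linarith
qed

text \<open>The condition is \<open>2 * \<epsilon> < 1 / (4 * extrapolation_const k)\<close> without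
  fractions. The set is finite for positive \<open>\<epsilon>\<close>, as the constant is at least
  \<open>k + 1\<close>; inserting 0 gives \<open>Max\<close> a value when the set is empty, that is
  for \<open>\<epsilon>\<close> from 1/8 on.\<close>

definition matched_degree :: "real \<Rightarrow> nat" where
  "matched_degree \<epsilon> = Max (insert 0 {k. 8 * extrapolation_const k * \<epsilon> < 1})"

lemma finite_matched_degrees:
  assumes "0 < \<epsilon>"
  shows "finite {k. 8 * extrapolation_const k * \<epsilon> < 1}"
proof (rule finite_subset)
  show "{k. 8 * extrapolation_const k * \<epsilon> < 1} \<subseteq> {..nat \<lceil>1 / \<epsilon>\<rceil>}"
  proof
    fix k assume "k \<in> {k. 8 * extrapolation_const k * \<epsilon> < 1}"
    moreover have "real (Suc k) * 1 \<le> extrapolation_const k"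
      unfolding extrapolation_const_def by (intro mult_left_mono one_le_power) auto
    then have "8 * real k * \<epsilon> \<le> 8 * extrapolation_const k * \<epsilon>"
      using assms by (intro mult_right_mono) auto
    ultimately have "8 * real k * \<epsilon> < 1" by simp
    moreover have "real k * \<epsilon> \<le> 8 * real k * \<epsilon>" using assms by simp
    ultimately have "real k < 1 / \<epsilon>" using assms by (simp add: pos_less_divide_eq)
    then show "k \<in> {..nat \<lceil>1 / \<epsilon>\<rceil>}" by simp linarith
  qed
qed simp

text \<open>Below 1/10, hence below 1/8, degree 0 satisfies the condition itself because its
  constant is 1, so the inserted 0 does no harm.\<close>

lemma matched_degree_admissible:
  assumes "0 < \<epsilon>" "\<epsilon> < 1 / 10"
  shows "8 * extrapolation_const (matched_degree \<epsilon>) * \<epsilon> < 1"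
proof -
  have "matched_degree \<epsilon> \<in> insert 0 {k. 8 * extrapolation_const k * \<epsilon> < 1}"
    unfolding matched_degree_def by (rule Max_in) (use finite_matched_degrees[OF assms(1)] in auto)
  moreover have "8 * extrapolation_const 0 * \<epsilon> < 1"
    using assms by (simp add: extrapolation_const_def)
  ultimately show ?thesis by auto
qed

lemma filterlim_matched_degree: "filterlim matched_degree at_top (at_right 0)"
  unfolding filterlim_at_top
proof
  fix Z :: nat
  have L: "extrapolation_const Z > 0" using extrapolation_const_ge_1[of Z] by simp
  show "\<forall>\<^sub>F \<epsilon> in at_right 0. Z \<le> matched_degree \<epsilon>"
    unfolding eventually_at_right_field
  proof (intro exI[of _ "1 / (8 * extrapolation_const Z)"] conjI allI impI)
    fix \<epsilon> :: real assume \<epsilon>: "0 < \<epsilon>" "\<epsilon> < 1 / (8 * extrapolation_const Z)"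
    then have "8 * extrapolation_const Z * \<epsilon> < 1"
      using L by (simp add: field_simps)
    then show "Z \<le> matched_degree \<epsilon>"
      unfolding matched_degree_def using finite_matched_degrees[OF \<epsilon>(1)] by (intro Max_ge) auto
  qed (use L in simp)
qed

theorem theorem3p6:
  shows "\<exists>\<kappa> :: real \<Rightarrow> real. omega_exponent \<kappa> \<and>
    (\<forall>\<epsilon>\<in>{0<..<1/10}. \<forall>\<^sub>F d :: nat in sequentially. \<forall>(A :: algorithm) (\<delta> :: real).
       1 - \<delta> \<ge> 0.95 \<longrightarrow> tds_learner d (halfspace_intersections2 d) \<epsilon> \<delta> A \<longrightarrow>
         (\<exists>E\<in>environments d (halfspace_intersections2 d). \<exists>q \<phi>.
            makes_query A E q \<phi> \<and> sq_query d q \<phi> \<and> \<phi> \<le> real d powr (- \<kappa> \<epsilon>)) \<or>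
         (\<exists>E\<in>environments d (halfspace_intersections2 d). \<exists>n.
            takes_steps A E n \<and> real n \<ge> real d powr (\<kappa> \<epsilon>)))"
proof -
  \<comment> \<open>With y the eighth root of d, the power of d with this exponent is y^(k + 1), the
    bound on time and inverse tolerance that was refuted above.\<close>
  define \<kappa> where "\<kappa> \<epsilon> = real (Suc (matched_degree \<epsilon>)) / 8" for \<epsilon>
  have "filterlim (\<lambda>\<epsilon>. real (matched_degree \<epsilon>)) at_top (at_right 0)"
    by (rule filterlim_compose[OF filterlim_real_sequentially filterlim_matched_degree])
  then have "filterlim (\<lambda>\<epsilon>. (1 / 8) * (1 + real (matched_degree \<epsilon>))) at_top (at_right 0)"
    by (intro filterlim_tendsto_pos_mult_at_top[OF tendsto_const]
        filterlim_tendsto_add_at_top[OF tendsto_const]) auto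
  then have "omega_exponent \<kappa>"
    by (simp add: omega_exponent_def \<kappa>_def[abs_def] add.commute)
  moreover have "\<forall>\<^sub>F d :: nat in sequentially. \<forall>A \<delta>.
       1 - \<delta> \<ge> 0.95 \<longrightarrow> tds_learner d (halfspace_intersections2 d) \<epsilon> \<delta> A \<longrightarrow>
         (\<exists>E\<in>environments d (halfspace_intersections2 d). \<exists>q \<phi>.
            makes_query A E q \<phi> \<and> sq_query d q \<phi> \<and> \<phi> \<le> real d powr (- \<kappa> \<epsilon>)) \<or>
         (\<exists>E\<in>environments d (halfspace_intersections2 d). \<exists>n.
            takes_steps A E n \<and> real n \<ge> real d powr (\<kappa> \<epsilon>))"
    if \<epsilon>: "\<epsilon> \<in> {0<..<1/10}" for \<epsilon> :: real
  proof -
    define k where "k = matched_degree \<epsilon>"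
    let ?y = "\<lambda>d :: nat. real d powr (1 / 8)"
    let ?R = "6 * Suc k + 4"
    have adm: "2 * \<epsilon> < 1 / (4 * extrapolation_const k)"
      using matched_degree_admissible[of \<epsilon>] \<epsilon> extrapolation_const_ge_1[of k]
      by (simp add: k_def field_simps)
    \<comment> \<open>All requirements on the size of \<open>d\<close> involve only
      \<open>k\<close>, hence only \<open>\<epsilon>\<close>; the threshold is uniform over learners
      and \<open>\<delta>\<close>.\<close>
    have lim: "filterlim (\<lambda>d. (?y d)\<^sup>2) at_top sequentially" by real_asymp
    have "\<forall>\<^sub>F d in sequentially. ((?y d)\<^sup>2 + 1) ^ 3 < ?y d ^ 8" by real_asymp
    moreover have "\<forall>\<^sub>F d in sequentially. 5 * spike_const\<^sup>2 < ?y d ^ 8"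
    proof -
      have "filterlim (\<lambda>d. ?y d ^ 8) at_top sequentially" by real_asymp
      then show ?thesis unfolding filterlim_at_top_dense by blast
    qed
    moreover have "\<forall>\<^sub>F d in sequentially. 2 * real ?R \<le> (?y d)\<^sup>2"
      using lim unfolding filterlim_at_top by blast
    moreover have "\<forall>\<^sub>F d in sequentially. 4 * real ?R ^ (2 * Suc k) \<le> (?y d)\<^sup>2"
      using lim unfolding filterlim_at_top by blast
    moreover have "\<forall>\<^sub>F d :: nat in sequentially. 1 \<le> d" by (rule eventually_ge_at_top)
    ultimately show ?thesis
    proof eventually_elim
      case (elim d)
      let ?C = "halfspace_intersections2 d"
      have d0: "1 \<le> real d" using elim(5) by simp
      have y: "1 \<le> ?y d" using d0 by (rule ge_one_powr_ge_zero) simp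
      have root: "?y d ^ j = real d powr (real j / 8)" for j
      proof -
        have "?y d ^ j = ?y d powr real j" using y by (intro powr_realpow[symmetric]) linarith
        also have "\<dots> = real d powr (real j / 8)" by (simp only: powr_powr) simp
        finally show ?thesis .
      qed
      have d: "real d = ?y d ^ 8" using d0 by (simp only: root) simp
      have pow: "real d powr \<kappa> \<epsilon> = ?y d ^ Suc k" unfolding root \<kappa>_def k_def ..
      show ?case
      proof (intro allI impI, rule ccontr)
        fix A :: algorithm and \<delta> :: real
        assume \<delta>: "1 - \<delta> \<ge> 0.95" and A: "tds_learner d ?C \<epsilon> \<delta> A"
        assume neg: "\<not> ((\<exists>E\<in>environments d ?C. \<exists>q \<phi>.
            makes_query A E q \<phi> \<and> sq_query d q \<phi> \<and> \<phi> \<le> real d powr (- \<kappa> \<epsilon>)) \<or>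
         (\<exists>E\<in>environments d ?C. \<exists>n. takes_steps A E n \<and> real n \<ge> real d powr (\<kappa> \<epsilon>)))"
        have tol: "\<not> \<phi> \<le> real d powr (- \<kappa> \<epsilon>)"
            if "E \<in> environments d ?C" "makes_query A E q \<phi>" "sq_query d q \<phi>" for E q \<phi>
          using neg that by blast
        have steps: "\<not> takes_steps A E n"
            if "E \<in> environments d ?C" "real n \<ge> real d powr (\<kappa> \<epsilon>)" for E n
          using neg that by blast
        show False
        proof (rule no_fast_learner[OF y d _ _ _ _ adm _ A])
          fix E assume E: "E \<in> environments d ?C"
          have "\<not> takes_steps A E (nat \<lceil>?y d ^ Suc k\<rceil>)"
            by (rule steps[OF E]) (unfold pow, rule real_nat_ceiling_ge)
          then show "\<exists>t<nat \<lceil>?y d ^ Suc k\<rceil>. halting (action_at A E t)"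
            unfolding takes_steps_def by blast
        next
          fix E q \<phi> assume "E \<in> environments d ?C" "makes_query A E q \<phi>" "sq_query d q \<phi>"
          from tol[OF this] show "1 / ?y d ^ Suc k \<le> \<phi>"
            by (simp only: powr_minus pow inverse_eq_divide)
        qed (use elim(1-4) \<delta> in simp_all)
      qed
    qed
  qed
  ultimately show ?thesis by blast
qed

end
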